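(* Let $\mu$ be a finitely supported strictly non-degenerate probability measure on the group $\widetilde F$. Then for a.e. sample path $(g_n)$ of the random walk $(\widetilde F,\mu)$ (issued from the identity) the configurations $\mathcal{C}_n=\mathcal{C}_{g_n}$ converge pointwise to a limit $\mathbb{Z}$-valued configuration $\mathcal{C}_\infty\in\operatorname{Fun}(\Gamma,\mathbb{Z})$, and the space $\operatorname{Fun}(\Gamma,\mathbb{Z})$, equipped with the action $g\cdot\mathcal{C}=\mathcal{C}_g+\mathbf{S}^g\mathcal{C}$ of $\widetilde F$ and endowed with the arising limit distribution $\lambda$ (the distribution of $\mathcal{C}_\infty$), is a non-trivial $\mu$-boundary. Therefore, the Poisson boundary $(\partial_\mu\widetilde F,\nu)$ of the random walk $(\widetilde F,\mu)$ is also non-trivial.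
   Context: **The group.** $\widetilde A,\widetilde B:\mathbb{R}\to\mathbb{R}$ are the piecewise linear homeomorphisms $\widetilde A(\gamma)=\gamma-1$ and $\widetilde B(\gamma)=\gamma$ for $\gamma\le 0$, $\widetilde B(\gamma)=\gamma/2$ for $0\le\gamma\le 2$, $\widetilde B(\gamma)=\gamma-1$ for $\gamma\ge 2$. $\widetilde F$ is the group of homeomorphisms of $\mathbb{R}$ generated by $\widetilde A,\widetilde B$ (isomorphic to Thompson's group $F$), with group operation $(g_1g_2)(\gamma)=g_2(g_1(\gamma))$, so that $\gamma.g=g(\gamma)$ is a right action. Every $g\in\widetilde F$ is piecewise linear with finitely many break points, all dyadic rational, and with slopes that are integer powers of 2. $\Gamma$ denotes the set $\mathbb{Z}[\frac12]$ of dyadic rationals (as the vertex set of the Schreier graph of $\widetilde F$ on this orbit). **Configurations.** $\operatorname{Fun}(\Gamma,\mathbb{Z})$ is the additive group of all functions $\Gamma\to\mathbb{Z}$ (with the product $\sigma$-algebra). For $g\in\widetilde F$ put $\mathbf{S}^g\varphi(\gamma)=\varphi(g(\gamma))$, and let $\mathcal{C}_g\in\operatorname{Fun}(\Gamma,\mathbb{Z})$ be the finitely supported configuration $\mathcal{C}_g(\gamma)=\log_2 g'(\gamma+0)-\log_2 g'(\gamma-0)$ (one-sided slopes). One has $\mathcal{C}_{g_1g_2}=\mathcal{C}_{g_1}+\mathbf{S}^{g_1}\mathcal{C}_{g_2}$, so $g\cdot\mathcal{C}=\mathcal{C}_g+\mathbf{S}^g\mathcal{C}$ is a left action of $\widetilde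 F$ on $\operatorname{Fun}(\Gamma,\mathbb{Z})$. **Random walks and boundaries.** For a probability measure $\mu$ on a countable group $G$, the random walk $(G,\mu)$ is the Markov chain on $G$ moving from $g$ to $gh$ with probability $\mu(h)$. The walk issued from the identity is $g_n=h_1h_2\cdots h_n$ with $h_i$ i.i.d. of law $\mu$; $\mathbf{P}$ is its law on the path space $G^{\mathbb{Z}_+}$. $\mu$ is strictly non-degenerate if the semigroup generated by $\operatorname{supp}\mu$ is $G$. The Poisson boundary $\partial_\mu G$ is the space of ergodic components of the time shift on $G^{\mathbb{Z}_+}$ with respect to the $\sigma$-finite Markov measure $\mathbf{P}_\#$ whose initial distribution is the counting measure on $G$; it carries the left $G$-action induced by coordinatewise left translation of paths, and the harmonic measure $\nu$, the image of $\mathbf{P}$. A $\mu$-boundary is a measure $G$-space $(B,\lambda)$ which is a $G$-equivariant measurable quotient of the Poisson boundary, with $\lambda$ the image of $\nu$. A $\mu$-boundary (in particular the Poisson boundary itself) is non-trivial if its measure is not a point measure. *)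

theory Defs
  imports
    "HOL-Probability.Probability"
    "HOL-Algebra.Generated_Groups"
    "HOL-Algebra.Group_Action"
begin

section \<open>The group\<close>

text \<open>The homeomorphisms of the line, with the product \<open>g\<^sub>1 g\<^sub>2 = g\<^sub>2 \<circ> g\<^sub>1\<close>, so that
  \<open>(\<gamma>, g) \<mapsto> g \<gamma>\<close> is a right action.\<close>

definition Homeo_line :: "(real \<Rightarrow> real) monoid" where
  "Homeo_line =
     \<lparr>carrier = {f. \<exists>f'. homeomorphism UNIV UNIV f f'},
      mult = (\<lambda>g\<^sub>1 g\<^sub>2. g\<^sub>2 \<circ> g\<^sub>1),
      one = id\<rparr>"

definition A_gen :: "real \<Rightarrow> real" where
  "A_gen \<gamma> = \<gamma> - 1"

definition B_gen :: "real \<Rightarrow> real" where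
  "B_gen \<gamma> = (if \<gamma> \<le> 0 then \<gamma> else if \<gamma> \<le> 2 then \<gamma> / 2 else \<gamma> - 1)"

definition F_tilde :: "(real \<Rightarrow> real) monoid" where
  "F_tilde = Homeo_line\<lparr>carrier := generate Homeo_line {A_gen, B_gen}\<rparr>"

definition dyadic_rationals :: "real set" where
  "dyadic_rationals = {of_int m / 2 ^ n | (m :: int) (n :: nat). True}"


section \<open>Configurations\<close>

text \<open>Configurations are functions on the dyadic rationals, extended by \<open>undefined\<close> to the
  other real numbers; they form the set \<open>dyadic_rationals \<rightarrow>\<^sub>E UNIV\<close>.\<close>

definition config_space :: "(real \<Rightarrow> int) measure" where
  "config_space = (\<Pi>\<^sub>M \<gamma>\<in>dyadic_rationals. count_space UNIV)"

text \<open>For \<open>g\<close> in the group the slopes are integer powers of 2, so the difference of their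
  logarithms is an integer and the floor only changes its type.\<close>

definition config :: "(real \<Rightarrow> real) \<Rightarrow> real \<Rightarrow> int" where
  "config g = (\<lambda>\<gamma>\<in>dyadic_rationals.
     \<lfloor>log 2 (vector_derivative g (at_right \<gamma>)) - log 2 (vector_derivative g (at_left \<gamma>))\<rfloor>)"

definition config_action :: "(real \<Rightarrow> real) \<Rightarrow> (real \<Rightarrow> int) \<Rightarrow> (real \<Rightarrow> int)" where
  "config_action g = (\<lambda>C \<in> space config_space. \<lambda>\<gamma>\<in>dyadic_rationals. config g \<gamma> + C (g \<gamma>))"

text \<open>The pointwise limit, for the discrete topology of the integers; where the limit does not
  exist, \<^const>\<open>lim\<close> has a fixed unspecified value.\<close>

definition limit_config :: "(nat \<Rightarrow> real \<Rightarrow> real) \<Rightarrow> real \<Rightarrow> int" where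
  "limit_config x = (\<lambda>\<gamma>\<in>dyadic_rationals. lim (\<lambda>n. config (x n) \<gamma>))"


section \<open>Random walks\<close>

inductive_set semigroup_generated :: "('a, 'b) monoid_scheme \<Rightarrow> 'a set \<Rightarrow> 'a set"
  for G and S where
    incl: "s \<in> S \<Longrightarrow> s \<in> semigroup_generated G S"
  | mult: "s \<in> semigroup_generated G S \<Longrightarrow> t \<in> semigroup_generated G S \<Longrightarrow>
      s \<otimes>\<^bsub>G\<^esub> t \<in> semigroup_generated G S"

definition strictly_nondegenerate :: "('a, 'b) monoid_scheme \<Rightarrow> 'a pmf \<Rightarrow> bool" where
  "strictly_nondegenerate G \<mu> \<longleftrightarrow> semigroup_generated G (set_pmf \<mu>) = carrier G"

definition path_space :: "('a, 'b) monoid_scheme \<Rightarrow> (nat \<Rightarrow> 'a) measure" where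
  "path_space G = (\<Pi>\<^sub>M n\<in>UNIV. count_space (carrier G))"

text \<open>The law of the sequence of increments. The restriction to \<open>carrier G\<close> keeps the underlying
  set countable, so that products of increments are measurable.\<close>

definition increments :: "('a, 'b) monoid_scheme \<Rightarrow> 'a pmf \<Rightarrow> (nat \<Rightarrow> 'a) measure" where
  "increments G \<mu> = (\<Pi>\<^sub>M n\<in>UNIV. restrict_space (measure_pmf \<mu>) (carrier G))"

primrec walk :: "('a, 'b) monoid_scheme \<Rightarrow> 'a \<Rightarrow> (nat \<Rightarrow> 'a) \<Rightarrow> nat \<Rightarrow> 'a" where
  "walk G g h 0 = g"
| "walk G g h (Suc n) = walk G g h n \<otimes>\<^bsub>G\<^esub> h n"

definition path_measure :: "('a, 'b) monoid_scheme \<Rightarrow> 'a pmf \<Rightarrow> (nat \<Rightarrow> 'a) measure" where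
  "path_measure G \<mu> = distr (increments G \<mu>) (path_space G) (walk G \<one>\<^bsub>G\<^esub>)"

text \<open>The sigma-finite Markov measure whose initial distribution is the counting measure.\<close>

definition path_measure_counting :: "('a, 'b) monoid_scheme \<Rightarrow> 'a pmf \<Rightarrow> (nat \<Rightarrow> 'a) measure" where
  "path_measure_counting G \<mu> =
     distr (count_space (carrier G) \<Otimes>\<^sub>M increments G \<mu>) (path_space G) (\<lambda>(g, h). walk G g h)"

definition time_shift :: "(nat \<Rightarrow> 'a) \<Rightarrow> (nat \<Rightarrow> 'a)" where
  "time_shift x = (\<lambda>n. x (Suc n))"

definition translate :: "('a, 'b) monoid_scheme \<Rightarrow> 'a \<Rightarrow> (nat \<Rightarrow> 'a) \<Rightarrow> (nat \<Rightarrow> 'a)" where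
  "translate G g x = (\<lambda>n. g \<otimes>\<^bsub>G\<^esub> x n)"


definition limit_distribution :: "(real \<Rightarrow> real) pmf \<Rightarrow> (real \<Rightarrow> int) measure" where
  "limit_distribution \<mu> = distr (path_measure F_tilde \<mu>) config_space limit_config"


section \<open>The Poisson boundary and its quotients\<close>

text \<open>The space of ergodic components of a transformation \<open>T\<close> of a measure space \<open>M\<close> is the
  standard Borel quotient of \<open>M\<close> whose sigma-algebra, lifted to \<open>M\<close>, is modulo null sets the
  sigma-algebra of all \<open>T\<close>-invariant sets. It is unique up to isomorphism modulo null sets, and is
  given by its projection \<open>\<pi>\<close> to a Polish space with the Borel sigma-algebra; the measures that it
  carries are images under \<open>\<pi>\<close>.\<close>

definition ergodic_components ::
  "'a measure \<Rightarrow> ('a \<Rightarrow> 'a) \<Rightarrow> ('a \<Rightarrow> 'b :: polish_space) \<Rightarrow> bool" where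
  "ergodic_components M T \<pi> \<longleftrightarrow>
     \<pi> \<in> borel_measurable M \<and>
     (AE x in M. \<pi> (T x) = \<pi> x) \<and>
     (\<forall>A \<in> sets M. T -` A \<inter> space M = A \<longrightarrow>
        (\<exists>B \<in> sets borel. AE x in M. x \<in> A \<longleftrightarrow> \<pi> x \<in> B))"

definition measurable_action ::
  "('a, 'c) monoid_scheme \<Rightarrow> 'b measure \<Rightarrow> ('a \<Rightarrow> 'b \<Rightarrow> 'b) \<Rightarrow> bool" where
  "measurable_action G M act \<longleftrightarrow>
     group_action G (space M) act \<and> (\<forall>g \<in> carrier G. act g \<in> M \<rightarrow>\<^sub>M M)"

text \<open>A measure \<open>G\<close>-space: the action preserves the measure class, but not necessarily the
  measure.\<close>

definition measure_G_space ::
  "('a, 'c) monoid_scheme \<Rightarrow> 'b measure \<Rightarrow> ('a \<Rightarrow> 'b \<Rightarrow> 'b) \<Rightarrow> bool" where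
  "measure_G_space G M act \<longleftrightarrow>
     measurable_action G M act \<and>
     (\<forall>g \<in> carrier G. null_sets (distr M M (act g)) = null_sets M)"

text \<open>The Poisson boundary, given by the projection \<open>\<pi>\<close> from the path space together with the
  action induced by the translations of paths.\<close>

definition poisson_boundary ::
  "('a, 'c) monoid_scheme \<Rightarrow> 'a pmf \<Rightarrow> ('a \<Rightarrow> 'b \<Rightarrow> 'b) \<Rightarrow> ((nat \<Rightarrow> 'a) \<Rightarrow> 'b :: polish_space) \<Rightarrow> bool"
  where
  "poisson_boundary G \<mu> act \<pi> \<longleftrightarrow>
     ergodic_components (path_measure_counting G \<mu>) time_shift \<pi> \<and>
     measurable_action G borel act \<and>
     (\<forall>g \<in> carrier G. AE x in path_measure_counting G \<mu>. \<pi> (translate G g x) = act g (\<pi> x))"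

definition harmonic_measure ::
  "('a, 'c) monoid_scheme \<Rightarrow> 'a pmf \<Rightarrow> ((nat \<Rightarrow> 'a) \<Rightarrow> 'b :: polish_space) \<Rightarrow> 'b measure" where
  "harmonic_measure G \<mu> \<pi> = distr (path_measure G \<mu>) borel \<pi>"

text \<open>Every standard Borel space embeds as a Borel subset of the real line, so it is no loss of
  generality to realize the Poisson boundary there. Equivariance of the quotient map \<open>\<phi>\<close> is almost
  everywhere with respect to the image of the Markov measure with the counting initial
  distribution, whose class is preserved by the action; if \<open>\<mu>\<close> is strictly non-degenerate, then
  the harmonic measure belongs to this class.\<close>

definition mu_boundary ::
  "('a, 'c) monoid_scheme \<Rightarrow> 'a pmf \<Rightarrow> 'b measure \<Rightarrow> ('a \<Rightarrow> 'b \<Rightarrow> 'b) \<Rightarrow> bool" where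
  "mu_boundary G \<mu> L act \<longleftrightarrow>
     measure_G_space G L act \<and>
     (\<exists>(act\<^sub>P :: 'a \<Rightarrow> real \<Rightarrow> real) \<pi> \<phi>.
        poisson_boundary G \<mu> act\<^sub>P \<pi> \<and>
        \<phi> \<in> borel \<rightarrow>\<^sub>M L \<and>
        (\<forall>g \<in> carrier G. AE \<xi> in distr (path_measure_counting G \<mu>) borel \<pi>.
           \<phi> (act\<^sub>P g \<xi>) = act g (\<phi> \<xi>)) \<and>
        L = distr (harmonic_measure G \<mu> \<pi>) L \<phi>)"

definition nontrivial_measure :: "'a measure \<Rightarrow> bool" where
  "nontrivial_measure M \<longleftrightarrow> \<not> (\<exists>x \<in> space M. M = return M x)"

end

(* The increment of the configuration at \<gamma> from time n to n + 1 is the value of a finitely supported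
   configuration at the point g_n \<gamma>, so the configurations converge as soon as the induced Markov
   chain on the orbits of the line visits every point finitely often. This chain is doubly stochastic,
   hence it suffices to bound u(x)^2 by the Dirichlet energy of u for finitely supported u. Since the
   support of \<mu> generates the group as a semigroup, the energy dominates the displacement of u under
   every group element, and the bound follows by averaging u over the levels of a binary tree: the
   maps B and A^(-1) B act on [0, 1) as x \<mapsto> x / 2 and x \<mapsto> (x + 1) / 2.

   The limit is shift-invariant, hence a function on the Poisson boundary, and its distribution
   \<lambda> is quasi-invariant. A point mass \<lambda> would thus be carried by a configuration C fixed by
   the group, but C 0 = C_B 0 + C (B 0) = -1 + C 0 is impossible. *)

theory Submission
  imports Defs
begin

section \<open>Finitely supported functions and transience\<close>

text \<open>The walk need not be symmetric, so reversibility is not at hand; what replaces it is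
  that all maps permute the line, taken as a discrete set. The Green function truncated at time N
  then has energy at most twice its value at the pole, and a bound of squared values by the energy
  turns this into a bound on that value. Passing from \<mu> to other group elements is a comparison
  of Dirichlet forms and only costs constants. They are spent on two maps that generate a free
  semigroup on [0, 1): level m of its tree has 2^m points, while Cauchy-Schwarz loses only 2^(m/2).

  The second obstacle is that a \<mu>-boundary presupposes a Poisson boundary. One has to be
  constructed on the real line, with an action that obeys the group laws at every point and not just
  almost everywhere. Quasi-invariance of \<lambda> comes from stationarity: the limit forgets the
  first step, which multiplies the path by a random s of law \<mu>.\<close>

definition displacement :: "('a \<Rightarrow> 'a) \<Rightarrow> ('a \<Rightarrow> real) \<Rightarrow> real" where
  "displacement g u = (\<Sum>\<^sub>\<infinity>x. (u (g x) - u x)\<^sup>2)"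

lemma finite_support_comp:
  assumes "bij g" "finite {x. u x \<noteq> (0::real)}"
  shows "finite {x. u (g x) \<noteq> 0}"
  using finite_vimageI[OF assms(2) bij_is_inj[OF assms(1)]] by (simp add: vimage_def)

lemma summable_on_finite_support:
  fixes f :: "'a \<Rightarrow> real"
  assumes "finite {x. f x \<noteq> 0}"
  shows "f summable_on A"
  by (rule finite_nonzero_values_imp_summable_on) (use assms in \<open>auto intro: finite_subset\<close>)

lemma sum_infsum_swap:
  fixes f :: "'b \<Rightarrow> 'a \<Rightarrow> real"
  assumes "finite H" "\<And>h. h \<in> H \<Longrightarrow> f h summable_on A"
  shows "(\<Sum>h\<in>H. \<Sum>\<^sub>\<infinity>x\<in>A. f h x) = (\<Sum>\<^sub>\<infinity>x\<in>A. \<Sum>h\<in>H. f h x)"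
proof -
  have "((\<lambda>x. \<Sum>h\<in>H. f h x) has_sum (\<Sum>h\<in>H. \<Sum>\<^sub>\<infinity>x\<in>A. f h x)) A"
    using assms by (induction rule: finite_induct) (auto intro: has_sum_add)
  then show ?thesis by (simp add: infsumI)
qed

lemma displacement_summable:
  assumes "bij g" "finite {x. u x \<noteq> (0::real)}"
  shows "(\<lambda>x. (u (g x) - u x)\<^sup>2) summable_on A"
proof (rule summable_on_finite_support)
  have "{x. (u (g x) - u x)\<^sup>2 \<noteq> 0} \<subseteq> {x. u (g x) \<noteq> 0} \<union> {x. u x \<noteq> 0}" by auto
  then show "finite {x. (u (g x) - u x)\<^sup>2 \<noteq> 0}"
    using finite_support_comp[OF assms] assms(2) by (meson finite_UnI finite_subset)
qed

lemma displacement_nonneg: "displacement g u \<ge> 0"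
  unfolding displacement_def by (rule infsum_nonneg) auto

lemma sum_le_displacement:
  assumes "bij g" "finite {x. u x \<noteq> 0}" "finite F"
  shows "(\<Sum>x\<in>F. (u (g x) - u x)\<^sup>2) \<le> displacement g u"
  unfolding displacement_def
  by (rule finite_sum_le_infsum[OF displacement_summable[OF assms(1,2)] assms(3)]) auto

text \<open>The increment of \<open>u\<close> along \<open>h \<circ> g\<close> splits at
  \<open>g x\<close> into two, and (a + b)^2 \<le> 2 a^2 + 2 b^2. Bijectivity of \<open>g\<close>
  reindexes the second sum, which runs over the points \<open>g x\<close>.\<close>

lemma displacement_comp_le:
  assumes "bij g" "bij h" "finite {x. u x \<noteq> 0}"
  shows "displacement (h \<circ> g) u \<le> 2 * displacement g u + 2 * displacement h u"
proof -
  let ?a = "\<lambda>x. (u (g x) - u x)\<^sup>2" and ?b = "\<lambda>x. (u (h (g x)) - u (g x))\<^sup>2"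
  have a: "?a summable_on UNIV" by (rule displacement_summable) (use assms in auto)
  have b: "?b summable_on UNIV"
    using summable_on_reindex_bij_betw[OF assms(1), of "\<lambda>x. (u (h x) - u x)\<^sup>2"]
      displacement_summable[OF assms(2,3)] by simp
  have "bij (h \<circ> g)" using assms bij_comp by auto
  have "displacement (h \<circ> g) u \<le> (\<Sum>\<^sub>\<infinity>x. 2 * ?a x + 2 * ?b x)"
    unfolding displacement_def
  proof (rule infsum_mono)
    show "(\<lambda>x. (u ((h \<circ> g) x) - u x)\<^sup>2) summable_on UNIV"
      by (rule displacement_summable) fact+
    show "(\<lambda>x. 2 * ?a x + 2 * ?b x) summable_on UNIV"
      by (intro summable_on_add summable_on_cmult_right a b)
    fix x
    \<comment> \<open>The square of the difference of the two increments.\<close>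
    have "0 \<le> (u (h (g x)) - 2 * u (g x) + u x)\<^sup>2" by simp
    then show "(u ((h \<circ> g) x) - u x)\<^sup>2 \<le> 2 * ?a x + 2 * ?b x"
      by (simp add: power2_eq_square algebra_simps)
  qed
  also have "\<dots> = 2 * displacement g u + 2 * (\<Sum>\<^sub>\<infinity>x. ?b x)"
    unfolding displacement_def
    by (subst infsum_add) (auto intro!: summable_on_cmult_right a b infsum_cmult_right' simp: infsum_cmult_right')
  also have "(\<Sum>\<^sub>\<infinity>x. ?b x) = displacement h u"
    unfolding displacement_def using infsum_reindex_bij_betw[OF assms(1), of "\<lambda>x. (u (h x) - u x)\<^sup>2"] by simp
  finally show ?thesis .
qed

text \<open>Since \<open>g\<close> permutes the points, \<open>u \<circ> g\<close> and
  \<open>u\<close> have the same sum of squares; only the mixed term depends on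
  \<open>g\<close>.\<close>

lemma displacement_expand:
  assumes "bij g" "finite {x. u x \<noteq> 0}"
  shows "displacement g u = 2 * (\<Sum>\<^sub>\<infinity>x. u x * u x) - 2 * (\<Sum>\<^sub>\<infinity>x. u x * u (g x))"
proof -
  let ?s = "\<lambda>x. u x * u x"
  have s: "?s summable_on UNIV"
    by (rule summable_on_finite_support) (use assms in \<open>auto intro: finite_subset\<close>)
  have sg: "(\<lambda>x. ?s (g x)) summable_on UNIV"
    using summable_on_reindex_bij_betw[OF assms(1), of ?s] s by simp
  have m: "(\<lambda>x. u x * u (g x)) summable_on UNIV"
    by (rule summable_on_finite_support) (use assms in \<open>auto intro: finite_subset\<close>)
  have "displacement g u = (\<Sum>\<^sub>\<infinity>x. (?s (g x) + ?s x) + (-2) * (u x * u (g x)))"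
    unfolding displacement_def by (rule infsum_cong) (simp add: power2_eq_square algebra_simps)
  also have "\<dots> = ((\<Sum>\<^sub>\<infinity>x. ?s (g x)) + (\<Sum>\<^sub>\<infinity>x. ?s x)) + (-2) * (\<Sum>\<^sub>\<infinity>x. u x * u (g x))"
    using s sg m by (simp only: infsum_add infsum_cmult_right' summable_on_add summable_on_cmult_right)
  also have "(\<Sum>\<^sub>\<infinity>x. ?s (g x)) = (\<Sum>\<^sub>\<infinity>x. ?s x)"
    using infsum_reindex_bij_betw[OF assms(1), of ?s] by simp
  finally show ?thesis by simp
qed

text \<open>The Dirichlet form of the walk, without the customary factor 1/2.\<close>

definition energy :: "('a \<Rightarrow> 'a) pmf \<Rightarrow> ('a \<Rightarrow> real) \<Rightarrow> real" where
  "energy \<mu> u = (\<Sum>h\<in>set_pmf \<mu>. pmf \<mu> h * displacement h u)"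

text \<open>The probability that the chain started at \<open>x\<close> is at \<open>z\<close> after
  \<open>n\<close> steps, as \<open>emeasure_walk\<close> confirms. The recursion is on the first
  step, so that as a function of the starting point this is the n-th power of the averaging operator
  applied to the indicator of \<open>z\<close>.\<close>

fun step_prob :: "('a \<Rightarrow> 'a) pmf \<Rightarrow> 'a \<Rightarrow> nat \<Rightarrow> 'a \<Rightarrow> real" where
  "step_prob \<mu> z 0 x = of_bool (x = z)"
| "step_prob \<mu> z (Suc n) x = (\<Sum>h\<in>set_pmf \<mu>. pmf \<mu> h * step_prob \<mu> z n (h x))"

lemma step_prob_nonneg: "step_prob \<mu> z n x \<ge> 0"
  by (induction n arbitrary: x) (auto intro!: sum_nonneg)

lemma step_prob_finite_support:
  assumes "finite (set_pmf \<mu>)" "\<And>h. h \<in> set_pmf \<mu> \<Longrightarrow> bij h"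
  shows "finite {x. step_prob \<mu> z n x \<noteq> 0}"
proof (induction n)
  case (Suc n)
  have "{x. step_prob \<mu> z (Suc n) x \<noteq> 0} \<subseteq> (\<Union>h\<in>set_pmf \<mu>. {x. step_prob \<mu> z n (h x) \<noteq> 0})"
  proof
    fix x
    assume "x \<in> {x. step_prob \<mu> z (Suc n) x \<noteq> 0}"
    then show "x \<in> (\<Union>h\<in>set_pmf \<mu>. {x. step_prob \<mu> z n (h x) \<noteq> 0})"
      using sum.neutral[of "set_pmf \<mu>" "\<lambda>h. pmf \<mu> h * step_prob \<mu> z n (h x)"] by auto
  qed
  moreover have "finite \<dots>" using assms Suc by (auto intro: finite_support_comp)
  ultimately show ?case by (rule finite_subset)
qed (auto intro: finite_subset)

text \<open>The operator \<open>Q u = (\<Sum>h. \<mu> h * u \<circ> h)\<close> is doubly stochastic, so the energy of \<open>u\<close> is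
  twice the inner product of \<open>u\<close> with \<open>u - Q u\<close>, which telescopes for a partial Green function.\<close>

lemma energy_green_le:
  fixes z :: 'a and \<mu> :: "('a \<Rightarrow> 'a) pmf"
  assumes fin: "finite (set_pmf \<mu>)" and bij: "\<And>h. h \<in> set_pmf \<mu> \<Longrightarrow> bij h"
  defines "u \<equiv> \<lambda>N x. \<Sum>n<N. step_prob \<mu> z n x"
  shows "finite {x. u N x \<noteq> 0}" "energy \<mu> (u N) \<le> 2 * u N z"
proof -
  have "{x. u N x \<noteq> 0} \<subseteq> (\<Union>n<N. {x. step_prob \<mu> z n x \<noteq> 0})"
    unfolding u_def
  proof
    fix x
    assume "x \<in> {x. (\<Sum>n<N. step_prob \<mu> z n x) \<noteq> 0}"
    then show "x \<in> (\<Union>n<N. {x. step_prob \<mu> z n x \<noteq> 0})"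
      using sum.neutral[of "{..<N}" "\<lambda>n. step_prob \<mu> z n x"] by blast
  qed
  moreover have "finite \<dots>" using step_prob_finite_support[OF fin bij] by auto
  ultimately show fu: "finite {x. u N x \<noteq> 0}" by (rule finite_subset)
  let ?v = "u N"
  have m: "(\<lambda>x. ?v x * w x) summable_on UNIV" for w
    by (rule summable_on_finite_support) (use fu in \<open>auto intro: finite_subset\<close>)
  \<comment> \<open>Averaging shifts the time index: the term of time 0, the indicator of
    \<open>z\<close>, is lost and the term of time \<open>N\<close> is gained.\<close>
  have Q: "(\<Sum>h\<in>set_pmf \<mu>. pmf \<mu> h * ?v (h x)) = ?v x - of_bool (x = z) + step_prob \<mu> z N x" for x
  proof -
    have "(\<Sum>h\<in>set_pmf \<mu>. pmf \<mu> h * ?v (h x)) = (\<Sum>n<N. step_prob \<mu> z (Suc n) x)"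
      unfolding u_def sum_distrib_left by (subst sum.swap) simp
    also have "\<dots> = ?v x - of_bool (x = z) + step_prob \<mu> z N x"
      using sum.lessThan_Suc_shift[of "\<lambda>n. step_prob \<mu> z n x" N] unfolding u_def by simp
    finally show ?thesis .
  qed
  have one: "(\<Sum>h\<in>set_pmf \<mu>. pmf \<mu> h) = 1" using sum_pmf_eq_1[OF fin] by simp
  have "energy \<mu> ?v = (\<Sum>h\<in>set_pmf \<mu>. pmf \<mu> h * (2 * (\<Sum>\<^sub>\<infinity>x. ?v x * ?v x)))
      - 2 * (\<Sum>h\<in>set_pmf \<mu>. (\<Sum>\<^sub>\<infinity>x. ?v x * (pmf \<mu> h * ?v (h x))))"
    unfolding energy_def sum_distrib_left sum_subtractf[symmetric]
  proof (rule sum.cong)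
    fix h assume "h \<in> set_pmf \<mu>"
    have "(\<Sum>\<^sub>\<infinity>x. ?v x * (pmf \<mu> h * ?v (h x))) = pmf \<mu> h * (\<Sum>\<^sub>\<infinity>x. ?v x * ?v (h x))"
      by (subst infsum_cmult_right'[symmetric]) (simp add: ac_simps)
    then show "pmf \<mu> h * displacement h ?v = pmf \<mu> h * (2 * (\<Sum>\<^sub>\<infinity>x. ?v x * ?v x))
      - 2 * (\<Sum>\<^sub>\<infinity>x. ?v x * (pmf \<mu> h * ?v (h x)))"
      unfolding displacement_expand[OF bij[OF \<open>h \<in> set_pmf \<mu>\<close>] fu] by (simp add: algebra_simps)
  qed simp
  also have "(\<Sum>h\<in>set_pmf \<mu>. pmf \<mu> h * (2 * (\<Sum>\<^sub>\<infinity>x. ?v x * ?v x))) = 2 * (\<Sum>\<^sub>\<infinity>x. ?v x * ?v x)"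
    unfolding sum_distrib_right[symmetric] one by simp
  also have "(\<Sum>h\<in>set_pmf \<mu>. (\<Sum>\<^sub>\<infinity>x. ?v x * (pmf \<mu> h * ?v (h x))))
      = (\<Sum>\<^sub>\<infinity>x. ?v x * (?v x - of_bool (x = z) + step_prob \<mu> z N x))"
    unfolding Q[symmetric] sum_distrib_left by (rule sum_infsum_swap[OF fin m])
  also have "\<dots> = (\<Sum>\<^sub>\<infinity>x. (?v x * ?v x + (-1) * (?v x * of_bool (x = z))) + ?v x * step_prob \<mu> z N x)"
    by (rule infsum_cong) (simp add: algebra_simps)
  also have "\<dots> = (\<Sum>\<^sub>\<infinity>x. ?v x * ?v x) + (-1) * (\<Sum>\<^sub>\<infinity>x. ?v x * of_bool (x = z))
      + (\<Sum>\<^sub>\<infinity>x. ?v x * step_prob \<mu> z N x)"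
    by (simp only: infsum_add infsum_cmult_right' summable_on_add summable_on_cmult_right m)
  also have "(\<Sum>\<^sub>\<infinity>x. ?v x * of_bool (x = z)) = ?v z"
    using infsum_cong_neutral[of "{z}" UNIV "?v" "\<lambda>x. ?v x * of_bool (x = z)"] by auto
  finally have "energy \<mu> ?v = 2 * ?v z - 2 * (\<Sum>\<^sub>\<infinity>x. ?v x * step_prob \<mu> z N x)" by simp
  moreover have "(\<Sum>\<^sub>\<infinity>x. ?v x * step_prob \<mu> z N x) \<ge> 0"
    by (rule infsum_nonneg) (auto simp: u_def step_prob_nonneg intro!: mult_nonneg_nonneg sum_nonneg)
  ultimately show "energy \<mu> ?v \<le> 2 * ?v z" by simp
qed

text \<open>At \<open>z\<close> the estimate improves itself: for the truncated Green function u,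
  u(z)^2 is at most d times the energy and the energy at most 2 u(z), so u(z) \<le> 2 d uniformly in
  the truncation. Then the energy is at most 4 d, whence u(x)^2 \<le> 4 c d at any other
  point.\<close>

lemma summable_step_prob:
  assumes fin: "finite (set_pmf \<mu>)" and bij: "\<And>h. h \<in> set_pmf \<mu> \<Longrightarrow> bij h"
    and bd: "\<And>x. \<exists>c. \<forall>u. finite {x. u x \<noteq> 0} \<longrightarrow> (u x)\<^sup>2 \<le> c * energy \<mu> u"
  shows "summable (\<lambda>n. step_prob \<mu> z n x)"
proof -
  define u where "u N x = (\<Sum>n<N. step_prob \<mu> z n x)" for N x
  note green = energy_green_le[OF fin bij, where z = z, folded u_def]
  have u0: "u N x \<ge> 0" for N x unfolding u_def by (auto intro: sum_nonneg step_prob_nonneg)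
  \<comment> \<open>The constants in \<open>bd\<close> have no sign; as the energy is nonnegative,
    absolute values will do.\<close>
  have bd': "\<exists>c\<ge>0. \<forall>u. finite {x. u x \<noteq> 0} \<longrightarrow> (u x)\<^sup>2 \<le> c * energy \<mu> u" for x
  proof -
    obtain c where "\<forall>u. finite {x. u x \<noteq> 0} \<longrightarrow> (u x)\<^sup>2 \<le> c * energy \<mu> u" using bd by blast
    moreover have "c * energy \<mu> u \<le> \<bar>c\<bar> * energy \<mu> u" for u
      by (intro mult_right_mono) (auto simp: energy_def intro!: sum_nonneg mult_nonneg_nonneg displacement_nonneg)
    ultimately show ?thesis by (meson abs_ge_zero order_trans)
  qed
  obtain c where c: "c \<ge> 0" "\<And>u. finite {x. u x \<noteq> 0} \<Longrightarrow> (u x)\<^sup>2 \<le> c * energy \<mu> u" using bd' by metis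
  obtain d where d: "d \<ge> 0" "\<And>u. finite {x. u x \<noteq> 0} \<Longrightarrow> (u z)\<^sup>2 \<le> d * energy \<mu> u" using bd' by metis
  have z: "u N z \<le> 2 * d" for N
  proof (cases "u N z = 0")
    case False
    have "(u N z)\<^sup>2 \<le> d * (2 * u N z)"
      using d(2)[OF green(1)] mult_left_mono[OF green(2) d(1)] by (rule order_trans) simp
    then show ?thesis using False u0[of N z] by (simp add: power2_eq_square)
  qed (use d in simp)
  have "(u N x)\<^sup>2 \<le> 4 * c * d" for N
  proof -
    have "(u N x)\<^sup>2 \<le> c * (2 * u N z)"
      using c(2)[OF green(1)] mult_left_mono[OF green(2) c(1)] by (rule order_trans) simp
    also have "\<dots> \<le> c * (2 * (2 * d))" using z c(1) by (intro mult_left_mono) auto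
    finally show ?thesis by simp
  qed
  then have "u N x \<le> sqrt (4 * c * d)" for N by (rule real_le_rsqrt)
  then show ?thesis
    unfolding u_def by (intro summableI_nonneg_bounded[OF step_prob_nonneg])
qed

section \<open>Averages over the levels of a binary tree\<close>

lemma abs_sum_le_displacement:
  assumes "bij g" "finite {x. u x \<noteq> 0}" "inj_on p {..<n::nat}"
  shows "\<bar>\<Sum>k<n. u (g (p k)) - u (p k)\<bar> \<le> sqrt n * sqrt (displacement g u)"
proof -
  let ?d = "\<lambda>k. u (g (p k)) - u (p k)"
  have "(\<Sum>k<n. ?d k)\<^sup>2 \<le> n * (\<Sum>k<n. (?d k)\<^sup>2)"
    using Cauchy_Schwarz_ineq_sum[of "\<lambda>_. 1" ?d "{..<n}"] by simp
  also have "(\<Sum>k<n. (?d k)\<^sup>2) = (\<Sum>x\<in>p ` {..<n}. (u (g x) - u x)\<^sup>2)"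
    using assms(3) by (simp add: sum.reindex)
  also have "real n * \<dots> \<le> n * displacement g u"
    by (intro mult_left_mono sum_le_displacement assms) auto
  finally have "\<bar>\<Sum>k<n. ?d k\<bar> \<le> sqrt (n * displacement g u)"
    by (metis real_le_rsqrt real_sqrt_abs real_sqrt_le_mono)
  then show ?thesis by (simp add: real_sqrt_mult)
qed

text \<open>The averages of \<open>u\<close> over the levels of the binary tree with root \<open>r\<close> in which \<open>x\<close> has
  the two children \<open>x / 2\<close> and \<open>(x + 1) / 2\<close>: their increments decay geometrically, so that
  \<open>u r\<close> is bounded by the displacement along the edges of the tree.\<close>

lemma dyadic_tree_bound:
  fixes u :: "real \<Rightarrow> real"
  assumes f: "bij f" "bij g" and fin: "finite {x. u x \<noteq> 0}"
    and f0: "\<And>x. 0 \<le> x \<Longrightarrow> x < 1 \<Longrightarrow> f x = x / 2"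
    and f1: "\<And>x. 0 \<le> x \<Longrightarrow> x < 1 \<Longrightarrow> g x = (x + 1) / 2"
    and r: "0 \<le> r" "r < 1"
  shows "(u r)\<^sup>2 \<le> 8 * (displacement f u + displacement g u)"
proof -
  \<comment> \<open>Level \<open>m\<close> consists of the points (r + k) / 2^m with k < 2^m. The
    children of point \<open>k\<close> carry the numbers \<open>k\<close> and 2^m + k on the next
    level, whose two halves are thus the images under \<open>f\<close> and \<open>g\<close>.\<close>
  define p where "p m k = (r + real k) / 2 ^ m" for m :: nat and k :: nat
  define a where "a m = (\<Sum>k<2^m. u (p m k)) / 2 ^ m" for m :: nat
  define S where "S = sqrt (displacement f u) + sqrt (displacement g u)"
  have S0: "S \<ge> 0" unfolding S_def by (simp add: displacement_nonneg)
  have inj: "inj_on (p m) {..<n}" for m n by (auto simp: inj_on_def p_def)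
  have p01: "0 \<le> p m k" "p m k < 1" if "k < 2 ^ m" for m k
  proof -
    have "real (k + 1) \<le> 2 ^ m" using that by (metis Suc_eq_plus1 Suc_leI of_nat_le_iff of_nat_numeral of_nat_power)
    then show "0 \<le> p m k" "p m k < 1" using r by (auto simp: p_def divide_simps)
  qed
  \<comment> \<open>Each half costs 2^(m/2) by Cauchy-Schwarz, and division by 2^(m + 1) leaves
    (sqrt 2 / 2)^m times S / 2. The ratio 3/4 is a rational upper bound of sqrt 2 / 2.\<close>
  have step: "\<bar>a (Suc m) - a m\<bar> \<le> (3/4) ^ m * (S / 2)" for m
  proof -
    have add: "(\<Sum>k<i + j. h k) = (\<Sum>k<i. h k) + (\<Sum>k<j. h (i + k))" for h :: "nat \<Rightarrow> real" and i j
      by (induction j) simp_all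
    have split: "(\<Sum>k<2^Suc m. h k) = (\<Sum>k<2^m. h k) + (\<Sum>k<2^m. h (2^m + k))" for h :: "nat \<Rightarrow> real"
      using add[of h "2^m" "2^m"] by (simp add: mult_2)
    have c0: "p (Suc m) k = f (p m k)" and c1: "p (Suc m) (2 ^ m + k) = g (p m k)" if "k < 2 ^ m" for k
      using f0[OF p01[OF that]] f1[OF p01[OF that]] by (auto simp: p_def field_simps)
    have "a (Suc m) = ((\<Sum>k<2^m. u (f (p m k))) + (\<Sum>k<2^m. u (g (p m k)))) / 2 ^ Suc m"
      unfolding a_def split using c0 c1 by simp
    then have "a (Suc m) - a m = ((\<Sum>k<2^m. u (f (p m k)) - u (p m k)) + (\<Sum>k<2^m. u (g (p m k)) - u (p m k))) / 2 ^ Suc m"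
      unfolding a_def by (simp add: sum_subtractf field_simps)
    also have "\<bar>\<dots>\<bar> \<le> (sqrt (2^m) * sqrt (displacement f u) + sqrt (2^m) * sqrt (displacement g u)) / 2 ^ Suc m"
      unfolding abs_divide
      using abs_sum_le_displacement[OF f(1) fin inj[of m "2^m"]]
        abs_sum_le_displacement[OF f(2) fin inj[of m "2^m"]]
      by (intro divide_mono) (auto intro: order_trans[OF abs_triangle_ineq add_mono])
    also have "\<dots> = (sqrt 2 / 2) ^ m * (S / 2)"
      by (simp add: S_def real_sqrt_power field_simps power_divide)
    also have "\<dots> \<le> (3/4) ^ m * (S / 2)"
    proof -
      have "sqrt 2 \<le> 3 / 2" by (rule real_le_lsqrt) (auto simp: power2_eq_square)
      then show ?thesis using S0 by (intro mult_right_mono power_mono) auto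
    qed
    finally show ?thesis .
  qed
  have tele: "\<bar>a m - a 0\<bar> \<le> (\<Sum>i<m. (3/4) ^ i * (S / 2))" for m
  proof (induction m)
    case (Suc m)
    have "\<bar>a (Suc m) - a 0\<bar> \<le> \<bar>a m - a 0\<bar> + \<bar>a (Suc m) - a m\<bar>" by simp
    then show ?case using add_mono[OF Suc step[of m]] unfolding sum.lessThan_Suc by (rule order_trans)
  qed simp
  \<comment> \<open>The full geometric series has sum 4, and 4 * (S / 2) = 2 * S.\<close>
  have geo: "(\<Sum>i<m. (3/4) ^ i * (S / 2)) \<le> 2 * S" for m
  proof -
    have "(\<Sum>i<m. (3/4::real) ^ i) \<le> 4"
      by (subst sum_gp_strict) auto
    from mult_right_mono[OF this, of "S / 2"] show ?thesis
      using S0 unfolding sum_distrib_right by simp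
  qed
  have lim: "a \<longlonglongrightarrow> 0"
  proof (rule Lim_null_comparison)
    \<comment> \<open>A level meets each point at most once, so its sum stays below the l1 norm
      \<open>U\<close> of \<open>u\<close>, while the average divides by 2^m.\<close>
    define U where "U = (\<Sum>x\<in>{x. u x \<noteq> 0}. \<bar>u x\<bar>)"
    show "(\<lambda>m. U * (1/2) ^ m) \<longlonglongrightarrow> 0"
      by (intro tendsto_mult_right_zero LIMSEQ_power_zero) auto
    have "\<bar>\<Sum>k<2^m. u (p m k)\<bar> \<le> U" for m
    proof -
      have "\<bar>\<Sum>k<2^m. u (p m k)\<bar> \<le> (\<Sum>k<2^m. \<bar>u (p m k)\<bar>)" by (rule sum_abs)
      also have "\<dots> = (\<Sum>x\<in>p m ` {..<2^m}. \<bar>u x\<bar>)" using inj by (simp add: sum.reindex)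
      also have "\<dots> = (\<Sum>x\<in>p m ` {..<2^m} \<inter> {x. u x \<noteq> 0}. \<bar>u x\<bar>)"
        by (rule sum.mono_neutral_right) auto
      also have "\<dots> \<le> U" unfolding U_def by (rule sum_mono2) (use fin in auto)
      finally show ?thesis .
    qed
    then show "\<forall>\<^sub>F m in sequentially. norm (a m) \<le> U * (1/2) ^ m"
      by (intro always_eventually) (simp add: a_def power_divide divide_right_mono)
  qed
  have "\<bar>a 0\<bar> \<le> 2 * S"
  proof -
    have "(\<lambda>m. \<bar>a m - a 0\<bar>) \<longlonglongrightarrow> \<bar>0 - a 0\<bar>" by (intro tendsto_intros lim)
    from LIMSEQ_le_const2[OF this] show ?thesis using order_trans[OF tele geo] by auto
  qed
  moreover have "a 0 = u r" by (simp add: a_def p_def)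
  ultimately have "(u r)\<^sup>2 \<le> (2 * S)\<^sup>2"
    using S0 abs_le_square_iff[of "u r" "2 * S"] by simp
  also have "\<dots> \<le> 8 * (displacement f u + displacement g u)"
  proof -
    have "0 \<le> (sqrt (displacement f u) - sqrt (displacement g u))\<^sup>2" by simp
    then show ?thesis
      using displacement_nonneg[of f u] displacement_nonneg[of g u]
      unfolding S_def by (simp add: power2_eq_square algebra_simps)
  qed
  finally show ?thesis .
qed

section \<open>The group\<close>

lemma Homeo_line_simps [simp]:
  "carrier Homeo_line = {f. \<exists>f'. homeomorphism UNIV UNIV f f'}"
  "g \<otimes>\<^bsub>Homeo_line\<^esub> h = h \<circ> g"
  "\<one>\<^bsub>Homeo_line\<^esub> = id"
  by (auto simp: Homeo_line_def)

lemma group_Homeo_line: "group Homeo_line"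
proof (rule groupI)
  fix f assume "f \<in> carrier Homeo_line"
  then obtain f' where f': "homeomorphism UNIV UNIV f f'" by auto
  then have "f' \<in> carrier Homeo_line" using homeomorphism_symD[OF f'] by auto
  moreover have "f \<circ> f' = id" using f' by (auto simp: homeomorphism_def)
  ultimately show "\<exists>f'\<in>carrier Homeo_line. f' \<otimes>\<^bsub>Homeo_line\<^esub> f = \<one>\<^bsub>Homeo_line\<^esub>" by auto
qed (auto intro: homeomorphism_compose homeomorphism_ident simp: comp_assoc id_def)

lemma homeomorphism_UNIV_bij:
  assumes "homeomorphism UNIV UNIV f f'"
  shows "bij f"
  by (rule o_bij[of f' f]) (use assms in \<open>auto simp: homeomorphism_def fun_eq_iff\<close>)

definition B_inv :: "real \<Rightarrow> real" where
  "B_inv \<gamma> = (if \<gamma> \<le> 0 then \<gamma> else if \<gamma> \<le> 1 then 2 * \<gamma> else \<gamma> + 1)"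

lemma homeomorphism_A: "homeomorphism UNIV UNIV A_gen (\<lambda>x. x + 1)"
  unfolding A_gen_def by (rule homeomorphismI) (auto intro!: continuous_intros)

lemma homeomorphism_B: "homeomorphism UNIV UNIV B_gen B_inv"
proof (rule homeomorphismI)
  \<comment> \<open>A lattice expression in affine maps is continuous without any gluing at the
    break points.\<close>
  have "B_gen = (\<lambda>x. min x (max (x / 2) (x - 1)))" by (auto simp: B_gen_def fun_eq_iff min_def max_def)
  from arg_cong[OF this, of "continuous_on UNIV"] show "continuous_on UNIV B_gen"
    by (auto intro!: continuous_intros)
  have "B_inv = (\<lambda>x. max x (min (2 * x) (x + 1)))" by (auto simp: B_inv_def fun_eq_iff min_def max_def)
  from arg_cong[OF this, of "continuous_on UNIV"] show "continuous_on UNIV B_inv"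
    by (auto intro!: continuous_intros)
qed (auto simp: B_gen_def B_inv_def)

lemma generators_in_Homeo_line: "{A_gen, B_gen} \<subseteq> carrier Homeo_line"
  using homeomorphism_A homeomorphism_B by auto

lemma inv_A: "inv\<^bsub>Homeo_line\<^esub> A_gen = (\<lambda>x. x + 1)"
  using homeomorphism_A homeomorphism_symD[OF homeomorphism_A]
  by (intro group.inv_equality[OF group_Homeo_line]) (auto simp: A_gen_def)

lemma inv_B: "inv\<^bsub>Homeo_line\<^esub> B_gen = B_inv"
proof (rule group.inv_equality[OF group_Homeo_line])
  show "B_inv \<otimes>\<^bsub>Homeo_line\<^esub> B_gen = \<one>\<^bsub>Homeo_line\<^esub>"
    using homeomorphism_B by (auto simp: homeomorphism_def)
qed (use homeomorphism_B homeomorphism_symD[OF homeomorphism_B] in auto)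

lemma carrier_F_tilde: "carrier F_tilde = generate Homeo_line {A_gen, B_gen}"
  by (simp add: F_tilde_def)

lemma F_tilde_simps [simp]:
  "g \<otimes>\<^bsub>F_tilde\<^esub> h = h \<circ> g"
  "\<one>\<^bsub>F_tilde\<^esub> = id"
  by (auto simp: F_tilde_def Homeo_line_def)

lemma group_F_tilde: "group F_tilde"
  unfolding F_tilde_def
  by (rule subgroup.subgroup_is_group[OF group.generate_is_subgroup[OF group_Homeo_line generators_in_Homeo_line] group_Homeo_line])

text \<open>Iterate the one-step closure; the stages increase, so two elements of the union share a
  stage. Used for the product of a group and, among sets, for the complement of a union.\<close>

lemma countable_binary_closure:
  assumes "countable X"
  shows "\<exists>C. countable C \<and> X \<subseteq> C \<and> (\<forall>a\<in>C. \<forall>b\<in>C. f a b \<in> C)"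
proof -
  define S where "S = rec_nat X (\<lambda>_ Y. Y \<union> (\<lambda>(a, b). f a b) ` (Y \<times> Y))"
  have S: "S 0 = X" "S (Suc n) = S n \<union> (\<lambda>(a, b). f a b) ` (S n \<times> S n)" for n
    by (simp_all add: S_def)
  have mono: "S m \<subseteq> S n" if "m \<le> n" for m n
    using that by (rule lift_Suc_mono_le[rotated]) (auto simp: S)
  have count: "countable (S n)" for n by (induction n) (auto simp: S assms)
  have closed: "f a b \<in> (\<Union>n. S n)" if "a \<in> (\<Union>n. S n)" "b \<in> (\<Union>n. S n)" for a b
  proof -
    from that obtain m n where "a \<in> S m" "b \<in> S n" by auto
    then have "a \<in> S (max m n)" "b \<in> S (max m n)"
      using mono[of m "max m n"] mono[of n "max m n"] by auto
    then have "(a, b) \<in> S (max m n) \<times> S (max m n)" by simp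
    then have "f a b \<in> S (Suc (max m n))" unfolding S(2) by force
    then show ?thesis by blast
  qed
  show ?thesis
  proof (intro exI conjI ballI)
    show "countable (\<Union>n. S n)" using count by simp
    show "X \<subseteq> (\<Union>n. S n)" using S(1) by blast
  qed (rule closed)
qed

lemma countable_generate:
  assumes "countable H"
  shows "countable (generate G H)"
proof -
  have "countable (insert \<one>\<^bsub>G\<^esub> (H \<union> m_inv G ` H))" using assms by simp
  from countable_binary_closure[OF this, of "mult G"]
  obtain C where C: "countable C" "insert \<one>\<^bsub>G\<^esub> (H \<union> m_inv G ` H) \<subseteq> C"
    "\<forall>a\<in>C. \<forall>b\<in>C. a \<otimes>\<^bsub>G\<^esub> b \<in> C"
    by (elim exE conjE)
  have "g \<in> C" if "g \<in> generate G H" for g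
    using that
  proof induction
    case (eng h1 h2)
    then show ?case using C(3) by simp
  qed (use C(2) in auto)
  then have "generate G H \<subseteq> C" by (rule subsetI)
  then show ?thesis using C(1) by (rule countable_subset)
qed

lemma countable_F_tilde: "countable (carrier F_tilde)"
  by (simp add: carrier_F_tilde countable_generate)

section \<open>One-sided slopes and the chain rule\<close>

lemma right_derivative_affine:
  assumes "e > 0" "\<And>y. x \<le> y \<Longrightarrow> y \<le> x + e \<Longrightarrow> g y = c * y + (d::real)"
  shows "(g has_vector_derivative c) (at_right x)"
proof -
  have "((\<lambda>y. c * y + d) has_vector_derivative c) (at x within {x..x + e})"
    by (auto intro!: derivative_eq_intros simp flip: has_real_derivative_iff_has_vector_derivative)
  then have "(g has_vector_derivative c) (at x within {x..x + e})"
    by (rule has_vector_derivative_transform[rotated 2]) (use assms in auto)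
  then show ?thesis using at_within_Icc_at_right[of x "x + e"] assms(1) by simp
qed

lemma left_derivative_affine:
  assumes "e > 0" "\<And>y. x - e \<le> y \<Longrightarrow> y \<le> x \<Longrightarrow> g y = c * y + (d::real)"
  shows "(g has_vector_derivative c) (at_left x)"
proof -
  have "((\<lambda>y. c * y + d) has_vector_derivative c) (at x within {x - e..x})"
    by (auto intro!: derivative_eq_intros simp flip: has_real_derivative_iff_has_vector_derivative)
  then have "(g has_vector_derivative c) (at x within {x - e..x})"
    by (rule has_vector_derivative_transform[rotated 2]) (use assms in auto)
  then show ?thesis using at_within_Icc_at_left[of "x - e" x] assms(1) by simp
qed

text \<open>What is kept of piecewise linearity. Monotonicity prevents a composition from mixing the
  two sides of a point, and slopes that are exact powers of 2 make the floor in
  \<open>config\<close> exact.\<close>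

definition dyadic_slopes :: "(real \<Rightarrow> real) \<Rightarrow> bool" where
  "dyadic_slopes g \<longleftrightarrow> strict_mono g \<and>
     (\<forall>x. \<exists>k::int. (g has_vector_derivative 2 powr k) (at_right x)) \<and>
     (\<forall>x. \<exists>k::int. (g has_vector_derivative 2 powr k) (at_left x))"

lemma right_derivative_comp:
  assumes "strict_mono g" "(g has_vector_derivative a) (at_right x)"
    "(h has_vector_derivative b) (at_right (g x))"
  shows "(h \<circ> g has_vector_derivative a * b) (at_right (x::real))"
proof -
  have "g ` {x<..} \<subseteq> {g x<..}" using assms(1) by (auto simp: strict_mono_def)
  from vector_diff_chain_within[OF assms(2) has_vector_derivative_within_subset[OF assms(3) this]]
  show ?thesis by simp
qed

lemma left_derivative_comp:
  assumes "strict_mono g" "(g has_vector_derivative a) (at_left x)"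
    "(h has_vector_derivative b) (at_left (g x))"
  shows "(h \<circ> g has_vector_derivative a * b) (at_left (x::real))"
proof -
  have "g ` {..<x} \<subseteq> {..<g x}" using assms(1) by (auto simp: strict_mono_def)
  from vector_diff_chain_within[OF assms(2) has_vector_derivative_within_subset[OF assms(3) this]]
  show ?thesis by simp
qed

lemma dyadic_slopes_comp:
  assumes "dyadic_slopes g" "dyadic_slopes h"
  shows "dyadic_slopes (h \<circ> g)"
  unfolding dyadic_slopes_def
proof (intro conjI allI)
  show "strict_mono (h \<circ> g)" using assms by (auto simp: dyadic_slopes_def strict_mono_def)
  fix x
  obtain k l :: int where "(g has_vector_derivative 2 powr k) (at_right x)"
    "(h has_vector_derivative 2 powr l) (at_right (g x))"
    using assms unfolding dyadic_slopes_def by blast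
  from right_derivative_comp[OF _ this] assms(1)
  show "\<exists>k::int. (h \<circ> g has_vector_derivative 2 powr k) (at_right x)"
    by (intro exI[of _ "k + l"]) (simp add: dyadic_slopes_def powr_add)
  obtain k l :: int where "(g has_vector_derivative 2 powr k) (at_left x)"
    "(h has_vector_derivative 2 powr l) (at_left (g x))"
    using assms unfolding dyadic_slopes_def by blast
  from left_derivative_comp[OF _ this] assms(1)
  show "\<exists>k::int. (h \<circ> g has_vector_derivative 2 powr k) (at_left x)"
    by (intro exI[of _ "k + l"]) (simp add: dyadic_slopes_def powr_add)
qed

lemma config_eqI:
  assumes "\<gamma> \<in> dyadic_rationals" "(g has_vector_derivative 2 powr of_int k) (at_right \<gamma>)"
    "(g has_vector_derivative 2 powr of_int l) (at_left \<gamma>)"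
  shows "config g \<gamma> = k - l"
  using assms vector_derivative_within[OF _ assms(2)] vector_derivative_within[OF _ assms(3)]
  by (simp add: config_def trivial_limit_at_right_real trivial_limit_at_left_real flip: of_int_diff)

text \<open>One-sided slopes multiply along a composition, so their logarithms add, separately on
  each side.\<close>

lemma config_comp:
  assumes "dyadic_slopes g" "dyadic_slopes h" "\<gamma> \<in> dyadic_rationals" "g \<gamma> \<in> dyadic_rationals"
  shows "config (h \<circ> g) \<gamma> = config g \<gamma> + config h (g \<gamma>)"
proof -
  obtain k l k' l' :: int where
    r: "(g has_vector_derivative 2 powr k) (at_right \<gamma>)" "(h has_vector_derivative 2 powr l) (at_right (g \<gamma>))"
    and l: "(g has_vector_derivative 2 powr k') (at_left \<gamma>)" "(h has_vector_derivative 2 powr l') (at_left (g \<gamma>))"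
    using assms unfolding dyadic_slopes_def by meson
  have m: "strict_mono g" using assms(1) by (simp add: dyadic_slopes_def)
  have "config (h \<circ> g) \<gamma> = (k + l) - (k' + l')"
    by (rule config_eqI[OF assms(3)])
      (use right_derivative_comp[OF m r] left_derivative_comp[OF m l] in \<open>simp_all add: powr_add\<close>)
  then show ?thesis
    using config_eqI[OF assms(3) r(1) l(1)] config_eqI[OF assms(4) r(2) l(2)] by simp
qed

lemma dyadic_slopes_affine:
  assumes "\<And>x. g x = x + d"
  shows "dyadic_slopes g" "config g \<gamma> = (if \<gamma> \<in> dyadic_rationals then 0 else undefined)"
proof -
  have r: "(g has_vector_derivative 2 powr (0::int)) (at_right x)" for x
    by (rule right_derivative_affine[of 1 _ _ _ d]) (auto simp: assms)
  have l: "(g has_vector_derivative 2 powr (0::int)) (at_left x)" for x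
    by (rule left_derivative_affine[of 1 _ _ _ d]) (auto simp: assms)
  have "strict_mono g" using assms by (auto simp: strict_mono_def)
  then show "dyadic_slopes g" unfolding dyadic_slopes_def using r l by blast
  show "config g \<gamma> = (if \<gamma> \<in> dyadic_rationals then 0 else undefined)"
    using config_eqI[OF _ r l] by (simp add: config_def)
qed

text \<open>The two half-open ranges differ exactly at the break points 0 and 2, which become the
  support of \<open>config B_gen\<close>. The radius given to the affine lemmas is the distance to
  the next break point on that side, or 1 if there is none.\<close>

lemma B_gen_slopes:
  "(B_gen has_vector_derivative 2 powr of_int (if 0 \<le> x \<and> x < 2 then -1 else 0)) (at_right x)"
  "(B_gen has_vector_derivative 2 powr of_int (if 0 < x \<and> x \<le> 2 then -1 else 0)) (at_left x)"
proof -
  consider "x < 0" | "0 \<le> x" "x < 2" | "x \<ge> 2" by linarith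
  then show "(B_gen has_vector_derivative 2 powr of_int (if 0 \<le> x \<and> x < 2 then -1 else 0)) (at_right x)"
  proof cases
    case 1
    then show ?thesis
      by (intro right_derivative_affine[of "-x" _ _ _ 0]) (auto simp: B_gen_def)
  next
    case 2
    then show ?thesis
      by (intro right_derivative_affine[of "2-x" _ _ _ 0]) (auto simp: B_gen_def powr_minus)
  next
    case 3
    then show ?thesis
      by (intro right_derivative_affine[of 1 _ _ _ "-1"]) (auto simp: B_gen_def)
  qed
  consider "x \<le> 0" | "0 < x" "x \<le> 2" | "x > 2" by linarith
  then show "(B_gen has_vector_derivative 2 powr of_int (if 0 < x \<and> x \<le> 2 then -1 else 0)) (at_left x)"
  proof cases
    case 1
    then show ?thesis
      by (intro left_derivative_affine[of 1 _ _ _ 0]) (auto simp: B_gen_def)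
  next
    case 2
    then show ?thesis
      by (intro left_derivative_affine[of x _ _ _ 0]) (auto simp: B_gen_def powr_minus)
  next
    case 3
    then show ?thesis
      by (intro left_derivative_affine[of "x-2" _ _ _ "-1"]) (auto simp: B_gen_def)
  qed
qed

lemma B_inv_slopes:
  "(B_inv has_vector_derivative 2 powr of_int (if 0 \<le> x \<and> x < 1 then 1 else 0)) (at_right x)"
  "(B_inv has_vector_derivative 2 powr of_int (if 0 < x \<and> x \<le> 1 then 1 else 0)) (at_left x)"
proof -
  consider "x < 0" | "0 \<le> x" "x < 1" | "x \<ge> 1" by linarith
  then show "(B_inv has_vector_derivative 2 powr of_int (if 0 \<le> x \<and> x < 1 then 1 else 0)) (at_right x)"
  proof cases
    case 1
    then show ?thesis
      by (intro right_derivative_affine[of "-x" _ _ _ 0]) (auto simp: B_inv_def)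
  next
    case 2
    then show ?thesis
      by (intro right_derivative_affine[of "1-x" _ _ _ 0]) (auto simp: B_inv_def)
  next
    case 3
    then show ?thesis
      by (intro right_derivative_affine[of 1 _ _ _ 1]) (auto simp: B_inv_def)
  qed
  consider "x \<le> 0" | "0 < x" "x \<le> 1" | "x > 1" by linarith
  then show "(B_inv has_vector_derivative 2 powr of_int (if 0 < x \<and> x \<le> 1 then 1 else 0)) (at_left x)"
  proof cases
    case 1
    then show ?thesis
      by (intro left_derivative_affine[of 1 _ _ _ 0]) (auto simp: B_inv_def)
  next
    case 2
    then show ?thesis
      by (intro left_derivative_affine[of x _ _ _ 0]) (auto simp: B_inv_def)
  next
    case 3
    then show ?thesis
      by (intro left_derivative_affine[of "x-1" _ _ _ 1]) (auto simp: B_inv_def)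
  qed
qed

lemma dyadic_slopes_B: "dyadic_slopes B_gen" "dyadic_slopes B_inv"
proof -
  have "strict_mono B_gen" "strict_mono B_inv"
    by (auto simp: strict_mono_def B_gen_def B_inv_def)
  moreover have "\<exists>k::int. (B_gen has_vector_derivative 2 powr k) (at_right x)"
    "\<exists>k::int. (B_gen has_vector_derivative 2 powr k) (at_left x)"
    "\<exists>k::int. (B_inv has_vector_derivative 2 powr k) (at_right x)"
    "\<exists>k::int. (B_inv has_vector_derivative 2 powr k) (at_left x)" for x
    using B_gen_slopes[of x] B_inv_slopes[of x]
    by blast+
  ultimately show "dyadic_slopes B_gen" "dyadic_slopes B_inv" unfolding dyadic_slopes_def by blast+
qed

lemma config_B:
  assumes "\<gamma> \<in> dyadic_rationals"
  shows "config B_gen \<gamma> = (if \<gamma> = 0 then -1 else if \<gamma> = 2 then 1 else 0)"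
    and "config B_inv \<gamma> = (if \<gamma> = 0 then 1 else if \<gamma> = 1 then -1 else 0)"
  using config_eqI[OF assms B_gen_slopes] config_eqI[OF assms B_inv_slopes]
  by simp_all

section \<open>The dyadic orbit and finiteness of the configurations\<close>

lemma dyadic_rationals_of_int: "of_int m \<in> dyadic_rationals"
  unfolding dyadic_rationals_def by (rule CollectI, rule exI[of _ m], rule exI[of _ 0]) simp

lemma dyadic_rationals_add:
  assumes "x \<in> dyadic_rationals" "y \<in> dyadic_rationals"
  shows "x + y \<in> dyadic_rationals"
proof -
  obtain m n k l where "x = of_int m / 2 ^ n" "y = of_int k / 2 ^ l"
    using assms by (auto simp: dyadic_rationals_def)
  then have "x + y = of_int (m * 2 ^ l + k * 2 ^ n) / 2 ^ (n + l)"
    by (simp add: add_frac_eq power_add)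
  then show ?thesis unfolding dyadic_rationals_def by blast
qed

lemma dyadic_rationals_half:
  assumes "x \<in> dyadic_rationals"
  shows "x / 2 \<in> dyadic_rationals"
proof -
  obtain m n where "x = of_int m / 2 ^ n" using assms by (auto simp: dyadic_rationals_def)
  then have "x / 2 = of_int m / 2 ^ Suc n" by simp
  then show ?thesis unfolding dyadic_rationals_def by blast
qed

lemma countable_dyadic_rationals: "countable dyadic_rationals"
proof -
  have "dyadic_rationals = (\<lambda>(m::int, n::nat). of_int m / 2 ^ n) ` UNIV"
    by (auto simp: dyadic_rationals_def)
  from arg_cong[OF this, of countable] show ?thesis by simp
qed

lemma dyadic_maps:
  assumes "\<gamma> \<in> dyadic_rationals"
  shows "A_gen \<gamma> \<in> dyadic_rationals" "\<gamma> + 1 \<in> dyadic_rationals"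
    "B_gen \<gamma> \<in> dyadic_rationals" "B_inv \<gamma> \<in> dyadic_rationals"
proof -
  have minus: "\<gamma> - 1 \<in> dyadic_rationals" and plus: "\<gamma> + 1 \<in> dyadic_rationals"
    using dyadic_rationals_add[OF assms dyadic_rationals_of_int[of "-1"]]
      dyadic_rationals_add[OF assms dyadic_rationals_of_int[of 1]] by simp_all
  have "2 * \<gamma> \<in> dyadic_rationals" using dyadic_rationals_add[OF assms assms] by simp
  then show "A_gen \<gamma> \<in> dyadic_rationals" "\<gamma> + 1 \<in> dyadic_rationals"
    "B_gen \<gamma> \<in> dyadic_rationals" "B_inv \<gamma> \<in> dyadic_rationals"
    using assms minus plus dyadic_rationals_half[OF assms]
    by (simp_all add: A_gen_def B_gen_def B_inv_def)
qed

lemma F_tilde_props: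
  assumes "g \<in> carrier F_tilde"
  shows F_tilde_bij: "bij g"
    and F_tilde_dyadic: "\<gamma> \<in> dyadic_rationals \<Longrightarrow> g \<gamma> \<in> dyadic_rationals"
    and F_tilde_slopes: "dyadic_slopes g"
    and F_tilde_finite: "finite {\<gamma>\<in>dyadic_rationals. config g \<gamma> \<noteq> 0}"
proof -
  interpret H: group Homeo_line by (rule group_Homeo_line)
  have "g \<in> carrier Homeo_line"
    by (rule H.generate_in_carrier[OF generators_in_Homeo_line]) (use assms carrier_F_tilde in simp)
  then obtain f where "homeomorphism UNIV UNIV g f" by auto
  then show "bij g" by (rule homeomorphism_UNIV_bij)
  have g: "g \<in> generate Homeo_line {A_gen, B_gen}" using assms by (simp add: carrier_F_tilde)
  \<comment> \<open>The first two clauses are what the cocycle identity asks for. By that identity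
    the configuration of a product lives on the support of the first factor and the preimage of the
    support of the second; injectivity makes this preimage finite.\<close>
  define P where "P g \<longleftrightarrow> (\<forall>\<gamma>\<in>dyadic_rationals. g \<gamma> \<in> dyadic_rationals) \<and> dyadic_slopes g \<and>
      finite {\<gamma>\<in>dyadic_rationals. config g \<gamma> \<noteq> 0} \<and> inj g" for g
  have affine: "P g" if d: "\<And>x. g x = x + d" and D: "d \<in> dyadic_rationals" for g d
  proof -
    have "finite {\<gamma>\<in>dyadic_rationals. config g \<gamma> \<noteq> 0}"
      unfolding dyadic_slopes_affine(2)[of g d, OF d] by simp
    moreover have "inj g" by (rule injI) (simp add: d)
    moreover have "g \<gamma> \<in> dyadic_rationals" if "\<gamma> \<in> dyadic_rationals" for \<gamma>
      unfolding d by (rule dyadic_rationals_add[OF that D])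
    ultimately show ?thesis using dyadic_slopes_affine(1)[of g d, OF d]
      unfolding P_def by simp
  qed
  have "P id" using affine[of id 0] dyadic_rationals_of_int[of 0] by simp
  have "P A_gen" using affine[of A_gen "-1"] dyadic_rationals_of_int[of "-1"] by (simp add: A_gen_def)
  have "P (\<lambda>x. x + 1)" using affine[of "\<lambda>x. x + 1" 1] dyadic_rationals_of_int[of 1] by simp
  have "finite {\<gamma>\<in>dyadic_rationals. config B_gen \<gamma> \<noteq> 0}"
    by (rule finite_subset[of _ "{0, 2}"]) (auto simp: config_B split: if_splits)
  then have "P B_gen"
    using dyadic_maps dyadic_slopes_B homeomorphism_UNIV_bij[OF homeomorphism_B] bij_is_inj
    unfolding P_def by blast
  have "finite {\<gamma>\<in>dyadic_rationals. config B_inv \<gamma> \<noteq> 0}"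
    by (rule finite_subset[of _ "{0, 1}"]) (auto simp: config_B split: if_splits)
  then have "P B_inv"
    using dyadic_maps dyadic_slopes_B homeomorphism_UNIV_bij[OF homeomorphism_symD[OF homeomorphism_B]] bij_is_inj
    unfolding P_def by blast
  have *: "P g"
    using g
  proof induction
    case one
    show ?case using \<open>P id\<close> by (simp add: id_def)
  next
    case (incl h)
    then consider "h = A_gen" | "h = B_gen" by blast
    then show ?case using \<open>P A_gen\<close> \<open>P B_gen\<close> by cases simp_all
  next
    case (inv h)
    then consider "h = A_gen" | "h = B_gen" by blast
    then show ?case using \<open>P (\<lambda>x. x + 1)\<close> \<open>P B_inv\<close> by cases (simp_all add: inv_A inv_B)
  next
    case (eng h1 h2)
    have "{\<gamma>\<in>dyadic_rationals. config (h2 \<circ> h1) \<gamma> \<noteq> 0} \<subseteq>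
      {\<gamma>\<in>dyadic_rationals. config h1 \<gamma> \<noteq> 0} \<union> h1 -` {\<gamma>\<in>dyadic_rationals. config h2 \<gamma> \<noteq> 0}"
      using eng.IH by (auto simp: config_comp P_def)
    moreover have "finite \<dots>" using eng.IH unfolding P_def by (blast intro: finite_vimageI)
    ultimately have "finite {\<gamma>\<in>dyadic_rationals. config (h2 \<circ> h1) \<gamma> \<noteq> 0}" by (rule finite_subset)
    moreover have "inj (h2 \<circ> h1)" "dyadic_slopes (h2 \<circ> h1)"
      using eng.IH unfolding P_def by (blast intro: inj_compose dyadic_slopes_comp)+
    ultimately show ?case using eng.IH unfolding P_def Homeo_line_simps by (simp add: o_def)
  qed
  then show "\<gamma> \<in> dyadic_rationals \<Longrightarrow> g \<gamma> \<in> dyadic_rationals" "dyadic_slopes g"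
    "finite {\<gamma>\<in>dyadic_rationals. config g \<gamma> \<noteq> 0}" unfolding P_def by auto
qed

lemma config_cocycle:
  assumes "g \<in> carrier F_tilde" "h \<in> carrier F_tilde" "\<gamma> \<in> dyadic_rationals"
  shows "config (g \<otimes>\<^bsub>F_tilde\<^esub> h) \<gamma> = config g \<gamma> + config h (g \<gamma>)"
  using config_comp[OF F_tilde_slopes[OF assms(1)] F_tilde_slopes[OF assms(2)] assms(3)]
    F_tilde_dyadic[OF assms(1,3)] by simp

section \<open>Random walks on countable groups\<close>

lemma AE_restrict_pmf:
  assumes "set_pmf \<mu> \<subseteq> A"
  shows "(AE s in restrict_space (measure_pmf \<mu>) A. P s) \<longleftrightarrow> (\<forall>s\<in>set_pmf \<mu>. P s)"
  using assms by (subst AE_restrict_space_iff) (auto simp: AE_measure_pmf_iff)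

locale countable_random_walk = group G for G (structure) +
  fixes \<mu> :: "'a pmf"
  assumes countable_carrier: "countable (carrier G)"
    and set_pmf_subset: "set_pmf \<mu> \<subseteq> carrier G"
begin

abbreviation "step \<equiv> restrict_space (measure_pmf \<mu>) (carrier G)"
abbreviation "incr \<equiv> increments G \<mu>"
abbreviation "paths \<equiv> path_space G"
abbreviation "Pone \<equiv> path_measure G \<mu>"
abbreviation "Pcount \<equiv> path_measure_counting G \<mu>"

lemma space_step [simp]: "space step = carrier G"
  by (simp add: space_restrict_space)

lemma sets_step: "sets step = sets (count_space (carrier G))"
  by (auto simp: sets_restrict_space)

lemma prob_space_step: "prob_space step"
  by (rule prob_space_restrict_space)
    (use set_pmf_subset in \<open>auto intro!: measure_pmf.emeasure_eq_1_AE simp: AE_measure_pmf_iff\<close>)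

text \<open>Recognizes the increments as an i.i.d. sequence, which gives access to
  \<open>PiM_iter\<close>: prepending an independent step does not change the law.\<close>

sublocale sequence_space step
  rewrites "(\<Pi>\<^sub>M i\<in>UNIV. step) = incr"
proof -
  interpret prob_space step by (rule prob_space_step)
  interpret product_prob_space "\<lambda>_. step" "UNIV :: nat set" by unfold_locales
  show "sequence_space step" by unfold_locales
  show "(\<Pi>\<^sub>M i\<in>UNIV. step) = incr" by (simp add: increments_def)
qed

lemma prob_space_incr: "prob_space incr"
  unfolding increments_def by (intro prob_space_PiM prob_space_step)

lemma sets_incr: "sets incr = sets paths"
  unfolding increments_def path_space_def by (intro sets_PiM_cong refl sets_step)

lemma space_paths: "space paths = {x. \<forall>n. x n \<in> carrier G}"
  by (auto simp: path_space_def space_PiM)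

lemma space_incr: "space incr = {x. \<forall>n. x n \<in> carrier G}"
  using sets_eq_imp_space_eq[OF sets_incr] space_paths by simp

lemma measurable_coord [measurable]: "(\<lambda>x. x n) \<in> paths \<rightarrow>\<^sub>M count_space (carrier G)"
  "(\<lambda>x. x n) \<in> incr \<rightarrow>\<^sub>M count_space (carrier G)"
  unfolding measurable_cong_sets[OF sets_incr refl]
  unfolding path_space_def by measurable

lemma measurable_paths:
  assumes "\<And>n. (\<lambda>x. f x n) \<in> N \<rightarrow>\<^sub>M count_space (carrier G)"
  shows "f \<in> N \<rightarrow>\<^sub>M paths"
  unfolding path_space_def
proof (rule measurable_PiM_single')
  show "f \<in> space N \<rightarrow> (\<Pi>\<^sub>E i\<in>UNIV. space (count_space (carrier G)))"
    using assms[THEN measurable_space] by auto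
qed (use assms in auto)

lemma measurable_mult:
  assumes f: "f \<in> N \<rightarrow>\<^sub>M count_space (carrier G)" and g: "g \<in> N \<rightarrow>\<^sub>M count_space (carrier G)"
  shows "(\<lambda>x. f x \<otimes> g x) \<in> N \<rightarrow>\<^sub>M count_space (carrier G)"
proof (rule measurable_compose_countable'[OF _ f countable_carrier])
  fix a assume "a \<in> carrier G"
  then show "(\<lambda>x. a \<otimes> g x) \<in> N \<rightarrow>\<^sub>M count_space (carrier G)"
    by (intro measurable_compose[OF g]) auto
qed

lemma walk_in_carrier:
  assumes "g \<in> carrier G" "h \<in> space incr"
  shows "walk G g h n \<in> carrier G"
  using assms by (induction n) (auto simp: space_incr)

text \<open>Increments multiply on the right, so a left factor of the starting point factors out of
  the whole path.\<close>

lemma walk_translate: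
  assumes "g \<in> carrier G" "k \<in> carrier G" "h \<in> space incr"
  shows "walk G (k \<otimes> g) h = translate G k (walk G g h)"
proof
  fix n show "walk G (k \<otimes> g) h n = translate G k (walk G g h) n"
    by (induction n) (use assms walk_in_carrier[OF assms(1,3)] in \<open>auto simp: translate_def m_assoc space_incr\<close>)
qed

text \<open>Deleting time 0 absorbs the first increment into the starting point; together with
  \<open>walk_translate\<close> this is the Markov property at time 1.\<close>

lemma walk_case_nat: "walk G g (case_nat s h) (Suc n) = walk G (g \<otimes> s) h n"
  by (induction n) auto

lemma measurable_walk [measurable]:
  assumes "g \<in> carrier G"
  shows "walk G g \<in> incr \<rightarrow>\<^sub>M paths"
proof (rule measurable_paths)
  fix n show "(\<lambda>h. walk G g h n) \<in> incr \<rightarrow>\<^sub>M count_space (carrier G)"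
    by (induction n) (use assms in \<open>auto intro!: measurable_mult\<close>)
qed

lemma measurable_walk_pair: "(\<lambda>(g, h). walk G g h) \<in> count_space (carrier G) \<Otimes>\<^sub>M incr \<rightarrow>\<^sub>M paths"
  by (rule measurable_pair_measure_countable1[OF countable_carrier]) (use measurable_walk in simp)

lemma measurable_translate [measurable]: "g \<in> carrier G \<Longrightarrow> translate G g \<in> paths \<rightarrow>\<^sub>M paths"
  unfolding translate_def by (intro measurable_paths measurable_mult) auto

lemma measurable_time_shift: "time_shift \<in> paths \<rightarrow>\<^sub>M paths"
  unfolding time_shift_def by (intro measurable_paths) auto

section \<open>Null sets of the two path measures\<close>

lemma sets_P1 [measurable_cong]: "sets Pone = sets paths" by (simp add: path_measure_def)
lemma sets_Pcount [measurable_cong]: "sets Pcount = sets paths" by (simp add: path_measure_counting_def)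
lemma space_P1 [simp]: "space Pone = space paths" by (simp add: path_measure_def)
lemma space_Pcount [simp]: "space Pcount = space paths" by (simp add: path_measure_counting_def)

lemma prob_space_P1: "prob_space Pone"
  unfolding path_measure_def by (intro prob_space.prob_space_distr prob_space_incr measurable_walk) auto

lemma translate_in_paths: "g \<in> carrier G \<Longrightarrow> x \<in> space paths \<Longrightarrow> translate G g x \<in> space paths"
  by (auto simp: space_paths translate_def)

lemma translate_mult:
  assumes "g \<in> carrier G" "k \<in> carrier G" "x \<in> space paths"
  shows "translate G g (translate G k x) = translate G (g \<otimes> k) x"
  using assms by (auto simp: translate_def m_assoc space_paths)

lemma AE_P1_iff:
  assumes [measurable]: "Measurable.pred paths Q"
  shows "(AE x in Pone. Q x) \<longleftrightarrow> (AE h in incr. Q (walk G \<one> h))"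
  unfolding path_measure_def by (rule AE_distr_iff) auto

text \<open>\<open>Pcount\<close> is the sum over \<open>g\<close> of the left translates of
  \<open>Pone\<close>; Fubini with the counting measure turns an almost everywhere statement into
  one for each \<open>g\<close>.\<close>

lemma AE_Pcount_iff:
  assumes [measurable]: "Measurable.pred paths Q"
  shows "(AE x in Pcount. Q x) \<longleftrightarrow> (\<forall>g\<in>carrier G. AE x in Pone. Q (translate G g x))"
proof -
  interpret I: prob_space incr by (rule prob_space_incr)
  interpret C: sigma_finite_measure "count_space (carrier G)"
    by (rule sigma_finite_measure_count_space_countable[OF countable_carrier])
  interpret pair_sigma_finite "count_space (carrier G)" incr ..
  have Q: "{x \<in> space paths. Q x} \<in> sets paths" by measurable
  have "(AE x in Pcount. Q x) \<longleftrightarrow> (AE gh in count_space (carrier G) \<Otimes>\<^sub>M incr. Q (walk G (fst gh) (snd gh)))"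
    unfolding path_measure_counting_def case_prod_beta
    by (rule AE_distr_iff[OF measurable_walk_pair[unfolded case_prod_beta] Q])
  also have "\<dots> \<longleftrightarrow> (AE g in count_space (carrier G). AE h in incr. Q (walk G g h))"
    by (rule AE_pair_iff[symmetric],
        rule measurable_sets_Collect[OF measurable_walk_pair[unfolded case_prod_beta] Q])
  also have "\<dots> \<longleftrightarrow> (\<forall>g\<in>carrier G. AE h in incr. Q (walk G g h))"
    by (rule AE_count_space)
  also have "\<dots> \<longleftrightarrow> (\<forall>g\<in>carrier G. AE x in Pone. Q (translate G g x))"
  proof (rule ball_cong[OF refl])
    fix g assume [measurable]: "g \<in> carrier G"
    have "(AE h in incr. Q (walk G g h)) \<longleftrightarrow> (AE h in incr. Q (translate G g (walk G \<one> h)))"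
      using walk_translate[OF one_closed \<open>g \<in> carrier G\<close>] \<open>g \<in> carrier G\<close> by (intro AE_cong) simp
    also have "\<dots> \<longleftrightarrow> (AE x in Pone. Q (translate G g x))"
      by (rule AE_P1_iff[symmetric]) measurable
    finally show "(AE h in incr. Q (walk G g h)) \<longleftrightarrow> (AE x in Pone. Q (translate G g x))" .
  qed
  finally show ?thesis .
qed

text \<open>Left translation permutes the summands of \<open>Pcount\<close> and so preserves its
  null sets. As \<open>Q\<close> is arbitrary, the argument passes through a measurable null set
  \<open>N\<close> containing the exceptions.\<close>

lemma AE_Pcount_translate:
  assumes "AE x in Pcount. Q x" "g \<in> carrier G"
  shows AE_Pcount_imp_P1: "AE x in Pone. Q (translate G g x)"
    and AE_Pcount_translated: "AE x in Pcount. Q (translate G g x)"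
proof -
  obtain N where N: "{x \<in> space Pcount. \<not> Q x} \<subseteq> N" "emeasure Pcount N = 0" "N \<in> sets Pcount"
    using assms(1) by (rule AE_E)
  then have [measurable]: "N \<in> sets paths" by (simp add: sets_Pcount)
  have "AE x in Pcount. x \<notin> N" using N by (intro AE_not_in) (simp add: null_sets_def)
  then have *: "AE x in Pone. translate G k x \<notin> N" if "k \<in> carrier G" for k
    using that by (subst (asm) AE_Pcount_iff) auto
  have imp: "Q (translate G k x)" if "x \<in> space paths" "translate G k x \<notin> N" "k \<in> carrier G" for k x
    using N(1) translate_in_paths[OF that(3,1)] that(2) by auto
  show "AE x in Pone. Q (translate G g x)"
    by (rule AE_mp[OF *[OF assms(2)]], rule AE_I2) (use imp[OF _ _ assms(2)] in simp)
  have "AE x in Pcount. translate G g x \<notin> N"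
  proof (subst AE_Pcount_iff)
    show "Measurable.pred paths (\<lambda>x. translate G g x \<notin> N)" using assms(2) by measurable
    show "\<forall>k\<in>carrier G. AE x in Pone. translate G g (translate G k x) \<notin> N"
    proof
      fix k assume k: "k \<in> carrier G"
      have "AE x in Pone. translate G (g \<otimes> k) x \<notin> N" using * assms(2) k by auto
      then show "AE x in Pone. translate G g (translate G k x) \<notin> N"
        by (rule AE_mp) (auto intro!: AE_I2 simp: translate_mult assms(2) k)
    qed
  qed
  then show "AE x in Pcount. Q (translate G g x)"
    by (rule AE_mp, intro AE_I2) (use imp[OF _ _ assms(2)] in simp)
qed

lemma measurable_case_nat_step:
  "(\<lambda>(s, h). case_nat s h) \<in> step \<Otimes>\<^sub>M incr \<rightarrow>\<^sub>M incr"
  unfolding increments_def by measurable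

text \<open>The shifted path is the first increment times an independent copy of the walk from the
  identity. A value \<open>s\<close> of positive mass can be conditioned on, so what holds almost
  surely for the shifted path holds for \<open>s\<close> times the walk.\<close>

lemma AE_P1_time_shift:
  assumes [measurable]: "Measurable.pred paths Q" and ae: "AE x in Pone. Q (time_shift x)"
    and s: "s \<in> set_pmf \<mu>"
  shows "AE x in Pone. Q (translate G s x)"
proof -
  interpret I: prob_space incr by (rule prob_space_incr)
  interpret pair_sigma_finite step incr ..
  note [measurable] = measurable_time_shift
  have sc: "s \<in> carrier G" using s set_pmf_subset by auto
  have "AE h in incr. Q (time_shift (walk G \<one> h))"
    using ae by (subst (asm) AE_P1_iff) auto
  then have "AE h in distr (step \<Otimes>\<^sub>M incr) incr (\<lambda>(s, h). case_nat s h). Q (time_shift (walk G \<one> h))"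
    by (subst PiM_iter)
  then have "AE sh in step \<Otimes>\<^sub>M incr. Q (time_shift (walk G \<one> (case sh of (s, h) \<Rightarrow> case_nat s h)))"
    by (subst (asm) AE_distr_iff[OF measurable_case_nat_step]) auto
  from AE_pair[OF this] have "AE s in step. AE h in incr. Q (time_shift (walk G \<one> (case_nat s h)))"
    by simp
  then have "AE h in incr. Q (time_shift (walk G \<one> (case_nat s h)))"
    using s by (simp add: AE_restrict_pmf[OF set_pmf_subset])
  moreover
  have "time_shift (walk G \<one> (case_nat s h)) = translate G s (walk G \<one> h)" if "h \<in> space incr" for h
  proof -
    have "time_shift (walk G \<one> (case_nat s h)) = walk G (\<one> \<otimes> s) h"
      by (rule ext) (simp add: time_shift_def walk_case_nat del: walk.simps)
    then show ?thesis using walk_translate[OF one_closed sc that] sc by simp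
  qed
  then have "AE h in incr. Q (time_shift (walk G \<one> (case_nat s h))) \<longrightarrow> Q (translate G s (walk G \<one> h))"
    by (intro AE_I2) simp
  ultimately have "AE h in incr. Q (translate G s (walk G \<one> h))" by (rule AE_mp)
  then show ?thesis using sc by (subst AE_P1_iff) auto
qed

end

section \<open>Transience on the line\<close>

locale F_tilde_walk =
  fixes \<mu> :: "(real \<Rightarrow> real) pmf"
  assumes supp: "set_pmf \<mu> \<subseteq> carrier F_tilde"
    and fin: "finite (set_pmf \<mu>)"
    and nondeg: "strictly_nondegenerate F_tilde \<mu>"
begin

sublocale countable_random_walk F_tilde \<mu>
  by (intro countable_random_walk.intro countable_random_walk_axioms.intro group_F_tilde countable_F_tilde supp)

lemma bij_supp: "h \<in> set_pmf \<mu> \<Longrightarrow> bij h"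
  using supp F_tilde_bij by blast

text \<open>By strict non-degeneracy every group element is a word in the support. A letter s costs
  1 / \<mu>(s), a product costs 2 K + 2 L by \<open>displacement_comp_le\<close>; the latter also
  asks for bijectivity, which is therefore carried through the induction.\<close>

lemma displacement_le_energy:
  assumes "s \<in> carrier F_tilde"
  shows "\<exists>K\<ge>0. \<forall>u. finite {x. u x \<noteq> 0} \<longrightarrow> displacement s u \<le> K * energy \<mu> u"
proof -
  have "s \<in> semigroup_generated F_tilde (set_pmf \<mu>)"
    using assms nondeg by (simp add: strictly_nondegenerate_def)
  then have "bij s \<and> (\<exists>K\<ge>0. \<forall>u. finite {x. u x \<noteq> 0} \<longrightarrow> displacement s u \<le> K * energy \<mu> u)"
  proof induction
    case (incl s)
    have "displacement s u \<le> 1 / pmf \<mu> s * energy \<mu> u" for u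
    proof -
      have "pmf \<mu> s * displacement s u \<le> energy \<mu> u"
        unfolding energy_def
        by (rule member_le_sum[OF incl _ fin]) (auto simp: displacement_nonneg)
      then show ?thesis using incl by (simp add: field_simps pmf_positive)
    qed
    then show ?case using bij_supp[OF incl] by (intro conjI exI[of _ "1 / pmf \<mu> s"]) simp_all
  next
    case (mult s t)
    then have bij: "bij s" "bij t" by auto
    from mult obtain K L where K: "K \<ge> 0" "\<And>u. finite {x. u x \<noteq> 0} \<Longrightarrow> displacement s u \<le> K * energy \<mu> u"
      and L: "L \<ge> 0" "\<And>u. finite {x. u x \<noteq> 0} \<Longrightarrow> displacement t u \<le> L * energy \<mu> u" by blast
    have "displacement (t \<circ> s) u \<le> (2 * K + 2 * L) * energy \<mu> u" if "finite {x. u x \<noteq> 0}" for u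
      using displacement_comp_le[OF bij that] K(2)[OF that] L(2)[OF that]
      by (simp add: algebra_simps)
    moreover have "2 * K + 2 * L \<ge> 0" using K(1) L(1) by simp
    moreover have "bij (t \<circ> s)" using bij by (rule bij_comp)
    ultimately show ?case unfolding F_tilde_simps(1) by blast
  qed
  then show ?thesis by simp
qed

lemma translation_in_F_tilde: "(\<lambda>x. x + of_int n) \<in> carrier F_tilde"
proof -
  have A: "A_gen \<in> carrier F_tilde" by (simp add: carrier_F_tilde generate.incl)
  have "(\<lambda>x. x + 1) \<in> carrier F_tilde" using generate.inv[of A_gen "{A_gen, B_gen}" Homeo_line] by (simp add: inv_A carrier_F_tilde)
  then have plus: "(\<lambda>x. x + real k) \<in> carrier F_tilde" for k
  proof (induction k)
    case (Suc k)
    from m_closed[OF Suc.IH[OF Suc.prems] Suc.prems] show ?case by (simp add: o_def ac_simps)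
  qed (use one_closed in \<open>simp add: id_def\<close>)
  have minus: "(\<lambda>x. x - real k) \<in> carrier F_tilde" for k
  proof (induction k)
    case (Suc k)
    from m_closed[OF Suc A] show ?case by (simp add: o_def A_gen_def algebra_simps)
  qed (use one_closed in \<open>simp add: id_def\<close>)
  show ?thesis using plus[of "nat n"] minus[of "nat (- n)"] by (cases "n \<ge> 0") (simp_all)
qed

lemma point_le_energy: "\<exists>c. \<forall>u. finite {x. u x \<noteq> 0} \<longrightarrow> (u x)\<^sup>2 \<le> c * energy \<mu> u"
proof -
  \<comment> \<open>On [0, 1) this is x \<mapsto> (x + 1) / 2, because \<open>B_gen\<close> halves
    on [1, 2). The translation \<open>t\<close> takes \<open>x\<close> to its fractional part, the
    root of the tree.\<close>
  define g where "g = B_gen \<circ> (\<lambda>x. x + of_int 1)"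
  define t where "t = (\<lambda>y::real. y + of_int (- \<lfloor>x\<rfloor>))"
  have B: "B_gen \<in> carrier F_tilde" by (simp add: carrier_F_tilde generate.incl)
  have t: "t \<in> carrier F_tilde" unfolding t_def by (rule translation_in_F_tilde)
  have g: "g \<in> carrier F_tilde"
    using m_closed[OF translation_in_F_tilde B] unfolding g_def F_tilde_simps(1) .
  obtain K where K: "\<And>u. finite {x. u x \<noteq> 0} \<Longrightarrow> displacement B_gen u \<le> K * energy \<mu> u"
    using displacement_le_energy[OF B] by blast
  obtain L where L: "\<And>u. finite {x. u x \<noteq> 0} \<Longrightarrow> displacement (g) u \<le> L * energy \<mu> u"
    using displacement_le_energy[OF g] by blast
  obtain T where T: "\<And>u. finite {x. u x \<noteq> 0} \<Longrightarrow> displacement t u \<le> T * energy \<mu> u"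
    using displacement_le_energy[OF t] by blast
  \<comment> \<open>16 is twice the constant 8 of the tree bound; the doubling and the term 2 * T
    pay for the move from \<open>x\<close> to \<open>t x\<close>.\<close>
  have "(u x)\<^sup>2 \<le> (16 * K + 16 * L + 2 * T) * energy \<mu> u" if u: "finite {x. u x \<noteq> 0}" for u
  proof -
    have r: "0 \<le> t x" "t x < 1" unfolding t_def by linarith+
    have "(u (t x))\<^sup>2 \<le> 8 * (displacement B_gen u + displacement (g) u)"
      by (rule dyadic_tree_bound[OF F_tilde_bij[OF B] F_tilde_bij[OF g] u _ _ r])
        (auto simp: B_gen_def g_def)
    moreover have "(u (t x) - u x)\<^sup>2 \<le> displacement t u"
      using sum_le_displacement[OF F_tilde_bij[OF t] u, of "{x}"] by simp
    moreover have "(u x)\<^sup>2 \<le> 2 * (u (t x))\<^sup>2 + 2 * (u (t x) - u x)\<^sup>2"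
    proof -
      \<comment> \<open>With a = u(t x) and c = u(x), the right side minus the left side is (2 a -
        c)^2.\<close>
      have "0 \<le> (2 * u (t x) - u x)\<^sup>2" by simp
      then show ?thesis by (simp add: power2_eq_square algebra_simps)
    qed
    moreover have "c \<le> 16 * d + 16 * e + 2 * f" if "a \<le> 8 * (d + e)" "b \<le> f" "c \<le> 2 * a + 2 * b"
      for a b c d e f :: real using that by argo
    ultimately have "(u x)\<^sup>2 \<le> 16 * displacement B_gen u + 16 * displacement g u + 2 * displacement t u"
      by blast
    also have "\<dots> \<le> 16 * (K * energy \<mu> u) + 16 * (L * energy \<mu> u) + 2 * (T * energy \<mu> u)"
      by (intro add_mono mult_left_mono K L T u) simp_all
    finally show ?thesis by (simp add: algebra_simps)
  qed
  then show ?thesis by blast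
qed

text \<open>Condition on the first increment \<open>s\<close>. Since the group acts on the right,
  \<gamma> is first moved to \<open>s \<gamma>\<close>, and a walk of length \<open>n\<close> is
  then applied to that point; this is the recursion of \<open>step_prob\<close>.\<close>

lemma emeasure_walk:
  "emeasure incr {h \<in> space incr. walk F_tilde id h n \<gamma> = z} = ennreal (step_prob \<mu> z n \<gamma>)"
proof (induction n arbitrary: \<gamma>)
  case 0
  show ?case using prob_space.emeasure_space_1[OF prob_space_incr] by auto
next
  case (Suc n)
  interpret I: prob_space incr by (rule prob_space_incr)
  let ?E = "\<lambda>n \<gamma>. {h \<in> space incr. walk F_tilde id h n \<gamma> = z}"
  have E: "?E n \<gamma> \<in> sets incr" for n \<gamma>
  proof -
    have "(\<lambda>h. walk F_tilde id h n) \<in> incr \<rightarrow>\<^sub>M count_space (carrier F_tilde)"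
      using measurable_compose[OF measurable_walk[OF one_closed] measurable_coord(1)] by simp
    from measurable_sets_Collect[OF this, of "\<lambda>g. g \<gamma> = z"] show ?thesis by simp
  qed
  have "emeasure incr (?E (Suc n) \<gamma>) = emeasure (distr (step \<Otimes>\<^sub>M incr) incr (\<lambda>(s, h). case_nat s h)) (?E (Suc n) \<gamma>)"
    by (subst PiM_iter) (rule refl)
  also have "\<dots> = emeasure (step \<Otimes>\<^sub>M incr) ((\<lambda>(s, h). case_nat s h) -` ?E (Suc n) \<gamma> \<inter> space (step \<Otimes>\<^sub>M incr))"
    (is "_ = emeasure _ ?X")
    by (rule emeasure_distr[OF measurable_case_nat_step E])
  also have "\<dots> = (\<integral>\<^sup>+s. emeasure incr (Pair s -` ?X) \<partial>step)"
    by (rule sigma_finite_measure.emeasure_pair_measure_alt[OF prob_space_imp_sigma_finite[OF prob_space_incr]], rule measurable_sets[OF measurable_case_nat_step E])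
  also have "\<dots> = (\<integral>\<^sup>+s. ennreal (step_prob \<mu> z n (s \<gamma>)) \<partial>step)"
  proof (rule nn_integral_cong)
    fix s assume "s \<in> space step"
    then have s: "s \<in> carrier F_tilde" by simp
    have "Pair s -` ?X = ?E n (s \<gamma>)"
    proof -
      have "walk F_tilde id (case_nat s h) (Suc n) \<gamma> = walk F_tilde id h n (s \<gamma>)" if "h \<in> space incr" for h
        using walk_translate[OF one_closed s that] s
        unfolding walk_case_nat by (simp add: translate_def)
      moreover have "case_nat s h \<in> space incr" if "h \<in> space incr" for h
        using that s unfolding space_incr by (auto split: nat.splits)
      ultimately show ?thesis using s by (auto simp: space_pair_measure simp del: walk.simps)
    qed
    then show "emeasure incr (Pair s -` ?X) = ennreal (step_prob \<mu> z n (s \<gamma>))"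
      by (simp add: Suc.IH)
  qed
  also have "\<dots> = (\<integral>\<^sup>+s. ennreal (step_prob \<mu> z n (s \<gamma>)) * indicator (carrier F_tilde) s \<partial>measure_pmf \<mu>)"
    by (rule nn_integral_restrict_space) simp
  also have "\<dots> = (\<Sum>s\<in>set_pmf \<mu>. ennreal (step_prob \<mu> z n (s \<gamma>)) * indicator (carrier F_tilde) s * pmf \<mu> s)"
    by (rule nn_integral_measure_pmf_finite[OF fin]) (rule zero_le)
  also have "\<dots> = (\<Sum>s\<in>set_pmf \<mu>. ennreal (pmf \<mu> s * step_prob \<mu> z n (s \<gamma>)))"
    using supp by (intro sum.cong refl) (auto simp: ennreal_mult' step_prob_nonneg mult.commute indicator_def)
  also have "\<dots> = ennreal (step_prob \<mu> z (Suc n) \<gamma>)"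
    by (simp add: sum_ennreal step_prob_nonneg)
  finally show ?case .
qed

lemma AE_visits_finite: "AE h in incr. \<forall>\<^sub>F n in sequentially. walk F_tilde id h n \<gamma> \<noteq> z"
proof -
  interpret I: prob_space incr by (rule prob_space_incr)
  let ?E = "\<lambda>n. {h \<in> space incr. walk F_tilde id h n \<gamma> = z}"
  have "AE h in incr. \<forall>\<^sub>F n in sequentially. h \<in> space incr - ?E n"
  proof (rule borel_cantelli_AE1)
    fix n
    have "(\<lambda>h. walk F_tilde id h n) \<in> incr \<rightarrow>\<^sub>M count_space (carrier F_tilde)"
      using measurable_compose[OF measurable_walk[OF one_closed] measurable_coord(1)] by simp
    from measurable_sets_Collect[OF this, of "\<lambda>g. g \<gamma> = z"] show "?E n \<in> sets incr" by simp
    show "emeasure incr (?E n) < \<infinity>" by (simp add: emeasure_walk)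
  next
    have "measure incr (?E n) = step_prob \<mu> z n \<gamma>" for n
      by (rule measure_eq_emeasure_eq_ennreal[OF step_prob_nonneg emeasure_walk])
    then show "summable (\<lambda>n. measure incr (?E n))"
      using summable_step_prob[OF fin bij_supp point_le_energy] by simp
  qed
  then show ?thesis
  proof (rule AE_mp, intro AE_I2 impI)
    fix h assume "\<forall>\<^sub>F n in sequentially. h \<in> space incr - ?E n" "h \<in> space incr"
    then show "\<forall>\<^sub>F n in sequentially. walk F_tilde id h n \<gamma> \<noteq> z"
      by (auto elim: eventually_mono)
  qed
qed

lemma AE_incr_supp: "AE h in incr. \<forall>n. h n \<in> set_pmf \<mu>"
proof (subst AE_all_countable, rule allI)
  fix n
  show "AE h in incr. h n \<in> set_pmf \<mu>"
    unfolding increments_def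
    by (rule AE_PiM_component) (use prob_space_step AE_restrict_pmf[OF supp] in auto)
qed

lemma AE_config_converges:
  assumes \<gamma>: "\<gamma> \<in> dyadic_rationals"
  shows "AE h in incr. convergent (\<lambda>n. config (walk F_tilde id h n) \<gamma>)"
proof -
  \<comment> \<open>A finite set that catches every dyadic point where some increment in the support
    has a nonzero configuration. After the last visit of \<open>?w n \<gamma>\<close> to
    \<open>Z\<close> the value at \<gamma> is frozen.\<close>
  define Z where "Z = (\<Union>s\<in>set_pmf \<mu>. {\<gamma>\<in>dyadic_rationals. config s \<gamma> \<noteq> 0})"
  have "finite Z" unfolding Z_def by (intro finite_UN_I fin F_tilde_finite subsetD[OF supp])
  then have "AE h in incr. \<forall>z\<in>Z. \<forall>\<^sub>F n in sequentially. walk F_tilde id h n \<gamma> \<noteq> z"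
    by (intro AE_finite_allI AE_visits_finite)
  moreover note AE_incr_supp
  moreover have "AE h in incr. h \<in> space incr" by (rule AE_space)
  ultimately show ?thesis
  proof eventually_elim
    case (elim h)
    let ?w = "walk F_tilde id h"
    have w: "?w n \<in> carrier F_tilde" for n using walk_in_carrier[OF one_closed elim(3)] by simp
    have "\<forall>\<^sub>F n in sequentially. \<forall>z\<in>Z. ?w n \<gamma> \<noteq> z"
      using elim(1) \<open>finite Z\<close> by (simp add: eventually_ball_finite_distrib)
    then obtain N where N: "\<And>n. n \<ge> N \<Longrightarrow> ?w n \<gamma> \<notin> Z" unfolding eventually_sequentially by blast
    have "config (?w n) \<gamma> = config (?w N) \<gamma>" if "n \<ge> N" for n
      using that
    proof (induction n rule: dec_induct)
      case (step n)
      have "?w n \<gamma> \<in> dyadic_rationals" using F_tilde_dyadic[OF w \<gamma>] .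
      moreover have "?w n \<gamma> \<notin> Z" using N step(1) by simp
      ultimately have "config (h n) (?w n \<gamma>) = 0" using elim(2) unfolding Z_def by simp
      moreover have "h n \<in> carrier F_tilde" using elim(2) supp by blast
      ultimately show ?case
        using config_cocycle[OF w[of n] _ \<gamma>, of "h n"] step(3) unfolding walk.simps(2) by linarith
    qed simp
    then have "(\<lambda>n. config (?w n) \<gamma>) \<longlonglongrightarrow> config (?w N) \<gamma>"
      by (intro tendsto_eventually) (rule eventually_sequentiallyI)
    then show ?case by (rule convergentI)
  qed
qed

end

section \<open>Countable dense families and the Cantor set\<close>

text \<open>Two errors add up: the tail of the union beyond \<open>n\<close>, and the replacement of
  each of the first \<open>n\<close> sets.\<close>

lemma (in finite_measure) measure_symdiff_Union_le:
  fixes A C :: "nat \<Rightarrow> 'a set"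
  assumes "\<And>i. A i \<in> sets M" "\<And>i. C i \<in> sets M"
  shows "measure M (((\<Union>i. A i) - (\<Union>i<n. C i)) \<union> ((\<Union>i<n. C i) - (\<Union>i. A i)))
    \<le> (measure M (\<Union>i. A i) - measure M (\<Union>i<n. A i)) + (\<Sum>i<n. measure M ((A i - C i) \<union> (C i - A i)))"
proof -
  let ?D = "\<lambda>i. (A i - C i) \<union> (C i - A i)" and ?U = "\<Union>i. A i" and ?V = "\<Union>i<n. A i"
  have [measurable]: "A i \<in> sets M" "C i \<in> sets M" for i by (fact assms)+
  have "measure M ((?U - (\<Union>i<n. C i)) \<union> ((\<Union>i<n. C i) - ?U)) \<le> measure M ((?U - ?V) \<union> (\<Union>i<n. ?D i))"
    by (rule finite_measure_mono) (blast, measurable)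
  also have "\<dots> \<le> measure M (?U - ?V) + measure M (\<Union>i<n. ?D i)"
    by (rule measure_Un_le) measurable
  also have "measure M (\<Union>i<n. ?D i) \<le> (\<Sum>i<n. measure M (?D i))"
    by (rule finite_measure_subadditive_finite) auto
  also have "measure M (?U - ?V) = measure M ?U - measure M ?V"
    by (rule finite_measure_Diff) (measurable, blast)
  finally show ?thesis by simp
qed

text \<open>The algebra generated by a countable family is countable, and the sets that it
  approximates in measure form a sigma-algebra.\<close>

lemma (in finite_measure) countable_dense_sets:
  assumes gen: "sets M = sigma_sets (space M) E" and E: "countable E"
  shows "\<exists>D. countable D \<and> D \<noteq> {} \<and> D \<subseteq> sets M \<and>
    (\<forall>A\<in>sets M. \<forall>e>0. \<exists>C\<in>D. measure M ((A - C) \<union> (C - A)) < e)"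
proof -
  have "countable (insert {} E)" using E by simp
  \<comment> \<open>The complement of a union is a single binary operation that yields both
    complements (take a = b) and finite unions.\<close>
  from countable_binary_closure[OF this, of "\<lambda>a b. space M - (a \<union> b)"]
  obtain C where C: "countable C" "insert {} E \<subseteq> C" "\<forall>a\<in>C. \<forall>b\<in>C. space M - (a \<union> b) \<in> C"
    by (elim exE conjE)
  \<comment> \<open>\<open>C\<close> is only known to contain the generated sets, so members that
    are not measurable are discarded.\<close>
  define D where "D = C \<inter> sets M"
  have E_sets: "E \<subseteq> sets M" unfolding gen by (rule sigma_sets_superset_generator)
  have nor: "space M - (a \<union> b) \<in> D" if "a \<in> D" "b \<in> D" for a b
    using that C(3) unfolding D_def by auto
  have compl: "space M - a \<in> D" if "a \<in> D" for a using nor[OF that that] by simp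
  have un: "a \<union> b \<in> D" if "a \<in> D" "b \<in> D" for a b
  proof -
    have "a \<union> b \<subseteq> space M" using that sets.sets_into_space unfolding D_def by blast
    then have "space M - (space M - (a \<union> b)) = a \<union> b" by blast
    then show ?thesis using compl[OF nor[OF that]] by simp
  qed
  have empty: "{} \<in> D" using C(2) unfolding D_def by auto
  have Un: "(\<Union>i<n. c i) \<in> D" if "\<And>i. c i \<in> D" for c :: "nat \<Rightarrow> _" and n
    by (induction n) (use that un empty in \<open>auto simp: lessThan_Suc\<close>)
  let ?dist = "\<lambda>A B. measure M ((A - B) \<union> (B - A))"
  have "\<forall>e>0. \<exists>C\<in>D. ?dist A C < e" if "A \<in> sigma_sets (space M) E" for A
    using that
  proof induction
    case (Basic a)
    then have "a \<in> D" using C(2) E_sets unfolding D_def by auto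
    then show ?case by (intro allI impI bexI[of _ a]) simp_all
  next
    case Empty
    then show ?case using empty by (intro allI impI bexI[of _ "{}"]) simp_all
  next
    case (Compl a)
    have a: "a \<subseteq> space M" using Compl(1) sets.sets_into_space unfolding gen[symmetric] by blast
    show ?case
    proof (intro allI impI)
      fix e :: real assume "e > 0"
      then obtain B where B: "B \<in> D" "?dist a B < e" using Compl.IH by blast
      then have "B \<subseteq> space M" using sets.sets_into_space unfolding D_def by blast
      then have "(space M - a - (space M - B)) \<union> (space M - B - (space M - a)) = (a - B) \<union> (B - a)"
        using a by blast
      then show "\<exists>C\<in>D. ?dist (space M - a) C < e" using B compl[OF B(1)] by (intro bexI[of _ "space M - B"]) simp_all
    qed
  next
    case (Union a)
    have a: "a i \<in> sets M" for i using Union(1) gen by simp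
    show ?case
    proof (intro allI impI)
      fix e :: real assume e: "e > 0"
      have "(\<lambda>n. measure M (\<Union>i<n. a i)) \<longlonglongrightarrow> measure M (\<Union>n. \<Union>i<n. a i)"
      proof (rule finite_Lim_measure_incseq)
        show "incseq (\<lambda>n. \<Union>i<n. a i)" by (rule incseq_SucI) (auto simp: less_Suc_eq)
      qed (use a in auto)
      moreover have "(\<Union>n. \<Union>i<n. a i) = (\<Union>i. a i)" by (auto intro: lessI)
      ultimately have "(\<lambda>n. measure M (\<Union>i<n. a i)) \<longlonglongrightarrow> measure M (\<Union>i. a i)" by simp
      then have "\<forall>\<^sub>F n in sequentially. measure M (\<Union>i<n. a i) > measure M (\<Union>i. a i) - e / 2"
        by (rule order_tendstoD) (use e in simp)
      then obtain n where n: "measure M (\<Union>i<n. a i) > measure M (\<Union>i. a i) - e / 2"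
        by (auto simp: eventually_sequentially)
      \<comment> \<open>The tail has used half of \<open>e\<close>; the other half is shared by
        \<open>n\<close> sets. The denominator has n + 1 because \<open>n\<close> may be 0.\<close>
      have "\<forall>i. \<exists>B\<in>D. ?dist (a i) B < e / (2 * (real n + 1))"
        using Union.IH e by (simp add: add_pos_nonneg)
      then obtain B where B: "\<And>i. B i \<in> D" "\<And>i. ?dist (a i) (B i) < e / (2 * (real n + 1))" by metis
      have "(\<Sum>i<n. ?dist (a i) (B i)) \<le> (\<Sum>i<n. e / (2 * (real n + 1)))"
        by (intro sum_mono less_imp_le B)
      also have "\<dots> \<le> e / 2" using e by (simp add: divide_simps)
      finally have "?dist (\<Union>i. a i) (\<Union>i<n. B i) < e"
        using measure_symdiff_Union_le[of a B n, OF a] B(1) n unfolding D_def by fastforce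
      then show "\<exists>C\<in>D. ?dist (\<Union>i. a i) C < e" using Un[of B n] B(1) by blast
    qed
  qed
  then have "\<forall>A\<in>sets M. \<forall>e>0. \<exists>C\<in>D. ?dist A C < e" unfolding gen by blast
  moreover have "countable D" "D \<subseteq> sets M" using C(1) unfolding D_def by auto
  ultimately show ?thesis using empty by blast
qed

text \<open>Separability passes to the subfamily \<open>\<I>\<close> although it need not contain
  the dense sets: near each of these a member of \<open>\<I>\<close> is chosen whenever there is
  one. The resulting errors 2 * 2^(-k) are summable, so by Borel-Cantelli \<open>A\<close> is almost
  everywhere the lower limit of its approximations, an expression in countably many
  indicators.\<close>

lemma (in finite_measure) countable_dense_family:
  assumes gen: "sets M = sigma_sets (space M) E" and E: "countable E"
    and \<I>: "\<I> \<subseteq> sets M" "\<I> \<noteq> {}"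
  shows "\<exists>R::nat \<Rightarrow> 'a set. range R \<subseteq> \<I> \<and>
    (\<forall>A\<in>\<I>. \<exists>j::nat \<Rightarrow> nat. AE x in M. x \<in> A \<longleftrightarrow> (\<forall>\<^sub>F k in sequentially. x \<in> R (j k)))"
proof -
  obtain D where D: "countable D" "D \<noteq> {}" "D \<subseteq> sets M"
    "\<And>A e. A \<in> sets M \<Longrightarrow> e > 0 \<Longrightarrow> \<exists>C\<in>D. measure M ((A - C) \<union> (C - A)) < e"
    using countable_dense_sets[OF gen E] by metis
  let ?dist = "\<lambda>A B. measure M ((A - B) \<union> (B - A))"
  \<comment> \<open>The implication keeps the choice inside \<open>\<I>\<close> even when nothing
    there is near \<open>C\<close>.\<close>
  define S where "S C k = (SOME A. A \<in> \<I> \<and> ((\<exists>A\<in>\<I>. ?dist A C < (1/2) ^ k) \<longrightarrow> ?dist A C < (1/2) ^ k))"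
    for C and k :: nat
  have S: "S C k \<in> \<I> \<and> ((\<exists>A\<in>\<I>. ?dist A C < (1/2) ^ k) \<longrightarrow> ?dist (S C k) C < (1/2) ^ k)" for C k
    unfolding S_def by (rule someI_ex) (use \<I>(2) in blast)
  define F where "F = (\<lambda>(C, k). S C k) ` (D \<times> (UNIV :: nat set))"
  have F: "countable F" "F \<noteq> {}" "F \<subseteq> \<I>" unfolding F_def using D(1,2) S by auto
  define R where "R = from_nat_into F"
  have "range R = F" unfolding R_def by (rule range_from_nat_into[OF F(2,1)])
  have "\<exists>j::nat \<Rightarrow> nat. AE x in M. x \<in> A \<longleftrightarrow> (\<forall>\<^sub>F k in sequentially. x \<in> R (j k))" if A: "A \<in> \<I>" for A
  proof -
    have AM: "A \<in> sets M" using A \<I>(1) by blast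
    have "\<forall>k. \<exists>C\<in>D. ?dist A C < (1/2) ^ k" using D(4)[OF AM] by simp
    then obtain C where C: "\<And>k. C k \<in> D" "\<And>k. ?dist A (C k) < (1/2) ^ k" by metis
    define B where "B k = S (C k) k" for k
    have B: "B k \<in> \<I>" "?dist (B k) (C k) < (1/2) ^ k" for k
      using S[of "C k" k] C(2)[of k] A unfolding B_def by blast+
    have BM: "B k \<in> sets M" "C k \<in> sets M" for k using B(1) \<I>(1) C(1) D(3) by blast+
    have "\<forall>k. \<exists>j. R j = B k"
      using \<open>range R = F\<close> C(1) unfolding F_def B_def by (auto simp: set_eq_iff image_iff) metis
    then obtain j where j: "\<And>k. R (j k) = B k" by metis
    have dist: "?dist A (B k) \<le> 2 * (1/2) ^ k" for k
    proof -
      have "?dist A (B k) \<le> measure M (((A - C k) \<union> (C k - A)) \<union> ((B k - C k) \<union> (C k - B k)))"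
        by (rule finite_measure_mono) (use AM BM in auto)
      also have "\<dots> \<le> ?dist A (C k) + ?dist (B k) (C k)"
        by (rule measure_Un_le) (use AM BM in auto)
      finally show ?thesis using C(2)[of k] B(2)[of k] by linarith
    qed
    have "AE x in M. \<forall>\<^sub>F k in sequentially. x \<in> space M - ((A - B k) \<union> (B k - A))"
    proof (rule borel_cantelli_AE1)
      show "summable (\<lambda>k. ?dist A (B k))"
        by (rule summable_comparison_test_ev[OF always_eventually summable_mult[OF summable_geometric]])
          (use dist in auto)
    qed (use AM BM in \<open>auto simp: less_top[symmetric]\<close>)
    then have "AE x in M. x \<in> A \<longleftrightarrow> (\<forall>\<^sub>F k in sequentially. x \<in> R (j k))"
    proof eventually_elim
      case (elim x)
      show ?case
      proof (cases "x \<in> A")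
        case True
        have "\<forall>\<^sub>F k in sequentially. x \<in> R (j k)" using elim by eventually_elim (use True j in auto)
        then show ?thesis using True by simp
      next
        case False
        have "\<forall>\<^sub>F k in sequentially. x \<notin> R (j k)" using elim by eventually_elim (use False j in auto)
        then have "\<not> (\<forall>\<^sub>F k in sequentially. x \<in> R (j k))"
          using eventually_happens[OF eventually_conj] by fastforce
        then show ?thesis using False by simp
      qed
    qed
    then show ?thesis by blast
  qed
  then show ?thesis using F(3) \<open>range R = F\<close> by blast
qed

text \<open>Base 3 with digits 0 and 1: the digits after the first contribute at most 1/2, so
  comparison with 1 reads off the first digit and no number has two expansions.\<close>

definition cantor_embed :: "(nat \<Rightarrow> bool) \<Rightarrow> real" where
  "cantor_embed b = (\<Sum>n. of_bool (b n) * (1/3) ^ n)"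

text \<open>The rescaled remainder of the greedy expansion. It is defined and Borel on all reals,
  inside or outside the Cantor set.\<close>

primrec cantor_rem :: "real \<Rightarrow> nat \<Rightarrow> real" where
  "cantor_rem \<xi> 0 = \<xi>"
| "cantor_rem \<xi> (Suc n) = 3 * (cantor_rem \<xi> n - of_bool (cantor_rem \<xi> n \<ge> 1))"

definition cantor_digits :: "real \<Rightarrow> nat \<Rightarrow> bool" where
  "cantor_digits \<xi> n \<longleftrightarrow> cantor_rem \<xi> n \<ge> 1"

lemma cantor_summable: "summable (\<lambda>n. of_bool (b n) * (1/3::real) ^ n)"
  by (rule summable_comparison_test_ev[OF always_eventually summable_geometric[of "1/3"]]) auto

lemma cantor_embed_bounds: "0 \<le> cantor_embed b" "cantor_embed b \<le> 3/2"
proof -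
  show "0 \<le> cantor_embed b" unfolding cantor_embed_def by (intro suminf_nonneg cantor_summable) simp
  have "cantor_embed b \<le> (\<Sum>n. (1/3) ^ n)"
    unfolding cantor_embed_def by (intro suminf_le cantor_summable summable_geometric) auto
  also have "\<dots> = 3/2" by (subst suminf_geometric) auto
  finally show "cantor_embed b \<le> 3/2" .
qed

lemma cantor_embed_step: "cantor_embed b = of_bool (b 0) + cantor_embed (\<lambda>n. b (Suc n)) / 3"
proof -
  have "cantor_embed b = of_bool (b 0) + (\<Sum>n. of_bool (b (Suc n)) * (1/3) ^ Suc n)"
    unfolding cantor_embed_def using suminf_split_head[OF cantor_summable[of b]] by simp
  also have "(\<Sum>n. of_bool (b (Suc n)) * (1/3::real) ^ Suc n) = (\<Sum>n. 1/3 * (of_bool (b (Suc n)) * (1/3) ^ n))"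
    by (simp add: mult_ac)
  also have "\<dots> = 1/3 * cantor_embed (\<lambda>n. b (Suc n))"
    unfolding cantor_embed_def by (rule suminf_mult[OF cantor_summable])
  finally show ?thesis by simp
qed

lemma cantor_embed_ge_1: "cantor_embed b \<ge> 1 \<longleftrightarrow> b 0"
  using cantor_embed_step[of b] cantor_embed_bounds[of "\<lambda>n. b (Suc n)"] by (cases "b 0") auto

lemma cantor_rem_embed: "cantor_rem (cantor_embed b) n = cantor_embed (\<lambda>i. b (i + n))"
proof (induction n)
  case (Suc n)
  let ?c = "\<lambda>i. b (i + n)"
  have "3 * (cantor_embed ?c - of_bool (cantor_embed ?c \<ge> 1)) = cantor_embed (\<lambda>i. ?c (Suc i))"
    unfolding cantor_embed_ge_1 by (subst cantor_embed_step) simp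
  then show ?case by (simp add: Suc.IH)
qed simp

lemma cantor_digits_embed [simp]: "cantor_digits (cantor_embed b) = b"
  by (rule ext) (simp add: cantor_digits_def cantor_rem_embed cantor_embed_ge_1)

lemma measurable_cantor_rem [measurable]: "(\<lambda>\<xi>. cantor_rem \<xi> n) \<in> borel_measurable borel"
  by (induction n) simp_all

lemma measurable_cantor_digits [measurable]: "Measurable.pred borel (\<lambda>\<xi>. cantor_digits \<xi> n)"
  unfolding cantor_digits_def by measurable

lemma measurable_cantor_embed:
  assumes [measurable]: "\<And>n. Measurable.pred M (\<lambda>x. b x n)"
  shows "(\<lambda>x. cantor_embed (b x)) \<in> borel_measurable M"
  unfolding cantor_embed_def by measurable

text \<open>Bijectivity follows from the group laws, as the inverse element provides the inverse
  map. Extensionality belongs to the encoding of permutations in \<open>BijGroup\<close>.\<close>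

lemma group_actionI:
  fixes G (structure)
  assumes "group G"
    and closed: "\<And>g x. g \<in> carrier G \<Longrightarrow> x \<in> E \<Longrightarrow> f g x \<in> E"
    and ext: "\<And>g. g \<in> carrier G \<Longrightarrow> f g \<in> extensional E"
    and one: "\<And>x. x \<in> E \<Longrightarrow> f \<one> x = x"
    and mult: "\<And>g h x. g \<in> carrier G \<Longrightarrow> h \<in> carrier G \<Longrightarrow> x \<in> E \<Longrightarrow> f (g \<otimes> h) x = f g (f h x)"
  shows "group_action G E f"
proof -
  interpret group G by fact
  have "bij_betw (f g) E E" if "g \<in> carrier G" for g
    by (rule bij_betw_byWitness[where f' = "f (inv g)"])
      (use that closed one mult[OF inv_closed[OF that] that] mult[OF that inv_closed[OF that]] in auto)
  then show ?thesis
    unfolding group_action_def group_hom_def group_hom_axioms_def hom_def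
    using ext closed mult group_BijGroup
    by (auto simp: BijGroup_def Bij_def compose_def restrict_def fun_eq_iff extensional_def)
qed

section \<open>Existence of the Poisson boundary\<close>

context countable_random_walk begin

definition cylinders :: "(nat \<Rightarrow> 'a) set set" where
  "cylinders = {{x \<in> space paths. x n = g} | n g. g \<in> carrier G}"

lemma countable_cylinders: "countable cylinders"
proof -
  have "cylinders = (\<lambda>(n, g). {x \<in> space paths. x n = g}) ` (UNIV \<times> carrier G)"
    by (auto simp: cylinders_def)
  moreover have "countable (UNIV \<times> carrier G :: (nat \<times> 'a) set)" using countable_carrier by simp
  ultimately show ?thesis by (simp only: countable_image)
qed

lemma sets_paths_cylinders: "sets paths = sigma_sets (space paths) cylinders"
proof -
  let ?C = "count_space (carrier G)"
  have "sets paths = sigma_sets (space paths) {{x \<in> space paths. x i \<in> A} | i A. A \<in> sets ?C}"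
    using sets_PiM_single[of UNIV "\<lambda>_::nat. ?C"]
    unfolding path_space_def space_PiM by simp
  also have "\<dots> = sigma_sets (space paths) cylinders"
  proof (rule sigma_sets_eqI)
    fix a assume "a \<in> {{x \<in> space paths. x i \<in> A} | i A. A \<in> sets ?C}"
    then obtain i A where A: "A \<subseteq> carrier G" and a: "a = {x \<in> space paths. x i \<in> A}" by auto
    have "a = (\<Union>g\<in>A. {x \<in> space paths. x i = g})" unfolding a by auto
    also have "\<dots> \<in> sigma_sets (space paths) cylinders"
    proof (rule sigma_sets_UNION)
      show "countable ((\<lambda>g. {x \<in> space paths. x i = g}) ` A)"
        using countable_subset[OF A countable_carrier] by simp
      show "b \<in> sigma_sets (space paths) cylinders" if "b \<in> (\<lambda>g. {x \<in> space paths. x i = g}) ` A" for b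
        using that A by (intro sigma_sets.Basic) (auto simp: cylinders_def)
    qed
    finally show "a \<in> sigma_sets (space paths) cylinders" .
  next
    fix b assume "b \<in> cylinders"
    then obtain n g where "g \<in> carrier G" "b = {x \<in> space paths. x n = g}" by (auto simp: cylinders_def)
    then have "b \<in> {{x \<in> space paths. x i \<in> A} | i A. A \<in> sets ?C}"
      by (intro CollectI exI[of _ n] exI[of _ "{g}"]) auto
    then show "b \<in> sigma_sets (space paths) {{x \<in> space paths. x i \<in> A} | i A. A \<in> sets ?C}"
      by (rule sigma_sets.Basic)
  qed
  finally show ?thesis .
qed

text \<open>The paths that start at a given \<open>g\<close> have mass 1, and there are countably
  many \<open>g\<close>.\<close>

lemma sigma_finite_Pcount: "sigma_finite_measure Pcount"
proof
  let ?A = "\<lambda>g. {x \<in> space paths. x 0 = g}"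
  have meas: "?A g \<in> sets paths" if "g \<in> carrier G" for g
    using that unfolding sets_paths_cylinders by (intro sigma_sets.Basic) (auto simp: cylinders_def)
  have "emeasure Pcount (?A g) \<noteq> \<infinity>" if g: "g \<in> carrier G" for g
  proof -
    interpret sigma_finite_measure incr by (rule prob_space_imp_sigma_finite[OF prob_space_incr])
    let ?M = "count_space (carrier G) \<Otimes>\<^sub>M incr"
    have "emeasure Pcount (?A g) = emeasure ?M ((\<lambda>(g, h). walk G g h) -` ?A g \<inter> space ?M)"
      unfolding path_measure_counting_def by (rule emeasure_distr[OF measurable_walk_pair meas[OF g]])
    also have "(\<lambda>(g, h). walk G g h) -` ?A g \<inter> space ?M = {g} \<times> space incr"
      using g measurable_space[OF measurable_walk_pair] by (auto simp: space_pair_measure) 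
    also have "emeasure ?M \<dots> = emeasure (count_space (carrier G)) {g} * emeasure incr (space incr)"
      by (rule emeasure_pair_measure_Times) (use g in auto)
    also have "\<dots> = 1" using g prob_space.emeasure_space_1[OF prob_space_incr] by simp
    finally show ?thesis by simp
  qed
  moreover have "\<Union>(?A ` carrier G) = space paths" by (auto simp: space_paths)
  ultimately show "\<exists>A. countable A \<and> A \<subseteq> sets Pcount \<and> \<Union> A = space Pcount \<and> (\<forall>a\<in>A. emeasure Pcount a \<noteq> \<infinity>)"
    using meas countable_carrier by (intro exI[of _ "?A ` carrier G"]) (auto simp: sets_Pcount)
qed

text \<open>Density of a countable family is measured by a finite measure, while ergodic components
  refer to the sigma-finite one. As only null sets matter, a strictly positive integrable density
  bridges the two.\<close>

lemma finite_measure_equivalent: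
  "\<exists>N. finite_measure N \<and> sets N = sets paths \<and> (\<forall>Q. (AE x in N. Q x) \<longleftrightarrow> (AE x in Pcount. Q x))"
proof -
  interpret sigma_finite_measure Pcount by (rule sigma_finite_Pcount)
  obtain f where f: "f \<in> borel_measurable Pcount" "integral\<^sup>N Pcount f \<noteq> \<infinity>"
    "\<And>x. x \<in> space Pcount \<Longrightarrow> 0 < f x"
    using Ex_finite_integrable_function by blast
  let ?N = "density Pcount f"
  have "emeasure ?N (space Pcount) = (\<integral>\<^sup>+x. f x * indicator (space Pcount) x \<partial>Pcount)"
    by (rule emeasure_density[OF f(1) sets.top])
  also have "\<dots> = integral\<^sup>N Pcount f"
    by (rule nn_integral_cong) simp
  finally have "finite_measure ?N"
    using f(2) by (intro finite_measureI) simp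
  moreover have "(AE x in ?N. Q x) \<longleftrightarrow> (AE x in Pcount. Q x)" for Q
    unfolding AE_density[OF f(1)] by (rule AE_cong) (simp add: f(3))
  ultimately show ?thesis by (intro exI[of _ ?N]) (simp add: sets_Pcount)
qed

lemma time_shift_translate: "time_shift (translate G g x) = translate G g (time_shift x)"
  by (simp add: time_shift_def translate_def)

text \<open>The group acts on the indicators of the sets \<open>k\<inverse> R\<^sub>j\<close>, where \<open>R\<close> is dense among the
  shift-invariant sets, by permuting the indices \<open>(k, j)\<close>. This makes the induced action an action
  at every point of the Cantor set, and the Cantor set embeds into the line.\<close>

lemma poisson_boundary_exists:
  "\<exists>(act :: 'a \<Rightarrow> real \<Rightarrow> real) \<pi>. poisson_boundary G \<mu> act \<pi>"
proof -
  define \<I> where "\<I> = {A \<in> sets paths. time_shift -` A \<inter> space paths = A}"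
  obtain N where N: "finite_measure N" "sets N = sets paths" "\<And>Q. (AE x in N. Q x) \<longleftrightarrow> (AE x in Pcount. Q x)"
    using finite_measure_equivalent by (elim exE conjE) simp
  have gen: "sets N = sigma_sets (space N) cylinders"
    using N(2) sets_paths_cylinders sets_eq_imp_space_eq[OF N(2)] by simp
  have "\<I> \<subseteq> sets N" "\<I> \<noteq> {}" unfolding \<I>_def N(2) by auto
  from finite_measure.countable_dense_family[OF N(1) gen countable_cylinders this]
  obtain R :: "nat \<Rightarrow> (nat \<Rightarrow> 'a) set" where R: "range R \<subseteq> \<I>"
    "\<forall>A\<in>\<I>. \<exists>j::nat \<Rightarrow> nat. AE x in N. x \<in> A \<longleftrightarrow> (\<forall>\<^sub>F k in sequentially. x \<in> R (j k))"
    by (elim exE conjE)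
  have R_sets [measurable]: "R j \<in> sets paths" for j using R(1) unfolding \<I>_def by auto
  have R_inv: "time_shift x \<in> R j \<longleftrightarrow> x \<in> R j" if "x \<in> space paths" for x j
  proof -
    have "time_shift -` R j \<inter> space paths = R j" using R(1) unfolding \<I>_def by auto
    then show ?thesis using that by (auto simp: set_eq_iff)
  qed
  define I where "I = carrier G \<times> (UNIV :: nat set)"
  have I: "countable I" "infinite I" "I \<noteq> {}"
  proof -
    show "countable I" unfolding I_def using countable_carrier by simp
    show "infinite I" unfolding I_def using one_closed finite_cartesian_productD2[of "carrier G" "UNIV :: nat set"] by auto
    then show "I \<noteq> {}" by auto
  qed
  \<comment> \<open>The factor of natural numbers makes the index set infinite even for a finite
    group, so \<open>\<iota>\<close> and \<open>\<kappa>\<close> are mutually inverse.\<close>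
  define \<iota> where "\<iota> = from_nat_into I"
  define \<kappa> where "\<kappa> = to_nat_on I"
  have \<iota>: "\<iota> n \<in> I" for n unfolding \<iota>_def by (rule from_nat_into[OF I(3)])
  have \<iota>\<kappa>: "\<iota> (\<kappa> p) = p" if "p \<in> I" for p unfolding \<iota>_def \<kappa>_def by (rule from_nat_into_to_nat_on[OF I(1) that])
  have \<kappa>\<iota>: "\<kappa> (\<iota> n) = n" for n unfolding \<iota>_def \<kappa>_def by (rule to_nat_on_from_nat_into_infinite[OF I(1,2)])
  \<comment> \<open>A digit of index (k, j) records whether k x lies in \<open>R j\<close>. For the
    path g x it asks about (k g) x, hence the right multiplication of the first index in
    \<open>perm\<close>.\<close>
  define code where "code x n = (translate G (fst (\<iota> n)) x \<in> R (snd (\<iota> n)))" for x n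
  define perm where "perm g b n = b (\<kappa> (fst (\<iota> n) \<otimes> g, snd (\<iota> n)))" for g and b :: "nat \<Rightarrow> bool" and n
  have fst_\<iota>: "fst (\<iota> n) \<in> carrier G" for n using \<iota>[of n] unfolding I_def by auto
  have \<iota>\<kappa>': "\<iota> (\<kappa> (k, j)) = (k, j)" if "k \<in> carrier G" for k j using \<iota>\<kappa> that unfolding I_def by simp
  have perm_mult: "perm (g \<otimes> h) b = perm g (perm h b)" if "g \<in> carrier G" "h \<in> carrier G" for g h b
    by (rule ext) (simp add: perm_def \<iota>\<kappa>' fst_\<iota> that m_assoc)
  have perm_one: "perm \<one> b = b" for b
    by (rule ext) (simp add: perm_def fst_\<iota> \<kappa>\<iota>)
  have code_translate: "code (translate G g x) = perm g (code x)" if "g \<in> carrier G" "x \<in> space paths" for g x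
    by (rule ext) (simp add: perm_def code_def \<iota>\<kappa>' fst_\<iota> that translate_mult)
  \<comment> \<open>Off the embedded Cantor set the action is the identity, which keeps the group
    laws valid at every real number.\<close>
  define act where "act g \<xi> = (if cantor_embed (cantor_digits \<xi>) = \<xi> then cantor_embed (perm g (cantor_digits \<xi>)) else \<xi>)"
    for g \<xi>
  define \<pi> where "\<pi> x = cantor_embed (code x)" for x
  have act_\<pi>: "\<pi> (translate G g x) = act g (\<pi> x)" if "g \<in> carrier G" "x \<in> space paths" for g x
    using code_translate[OF that] by (simp add: act_def \<pi>_def)
  have shift: "\<pi> (time_shift x) = \<pi> x" if "x \<in> space paths" for x
    unfolding \<pi>_def code_def time_shift_translate[symmetric]
    by (simp add: R_inv translate_in_paths fst_\<iota> that)
  have \<pi>_meas: "\<pi> \<in> borel_measurable paths"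
    unfolding \<pi>_def
  proof (rule measurable_cantor_embed)
    fix n
    note [measurable] = measurable_translate[OF fst_\<iota>[of n]]
    show "Measurable.pred paths (\<lambda>x. code x n)" unfolding code_def by measurable
  qed
  have "group_action G (space borel) act"
  proof (rule group_actionI)
    show "group G" by (rule is_group)
    show "act \<one> \<xi> = \<xi>" for \<xi> by (simp add: act_def perm_one)
    show "act (g \<otimes> h) \<xi> = act g (act h \<xi>)" if "g \<in> carrier G" "h \<in> carrier G" for g h \<xi>
      using that by (simp add: act_def perm_mult)
  qed simp_all
  moreover have "act g \<in> borel_measurable borel" for g
  proof -
    have [measurable]: "(\<lambda>\<xi>. cantor_embed (cantor_digits \<xi>)) \<in> borel_measurable borel"
      "(\<lambda>\<xi>. cantor_embed (perm g (cantor_digits \<xi>))) \<in> borel_measurable borel"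
      by (rule measurable_cantor_embed, simp add: perm_def)+
    show ?thesis unfolding act_def by measurable
  qed
  ultimately have "measurable_action G borel act" unfolding measurable_action_def by simp
  moreover have "\<exists>B\<in>sets borel. AE x in Pcount. x \<in> A \<longleftrightarrow> \<pi> x \<in> B" if A: "A \<in> \<I>" for A
  proof -
    obtain j :: "nat \<Rightarrow> nat" where j: "AE x in Pcount. x \<in> A \<longleftrightarrow> (\<forall>\<^sub>F k in sequentially. x \<in> R (j k))"
      using bspec[OF R(2) A] unfolding N(3) by (elim exE)
    \<comment> \<open>The index with group element \<open>\<one>\<close> tests membership in
      \<open>R (j k)\<close> itself, so the lower limit of these sets becomes a Borel condition on
      digits.\<close>
    define B where "B = {\<xi> :: real. \<forall>\<^sub>F k in sequentially. cantor_digits \<xi> (\<kappa> (\<one>, j k))}"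
    have "Measurable.pred borel (\<lambda>\<xi>. \<exists>K. \<forall>k\<ge>K. cantor_digits \<xi> (\<kappa> (\<one>, j k)))"
      by measurable
    then have "B \<in> sets borel"
      unfolding B_def eventually_sequentially by (simp add: Measurable.pred_def)
    moreover have "x \<in> R (j k) \<longleftrightarrow> cantor_digits (\<pi> x) (\<kappa> (\<one>, j k))" if "x \<in> space paths" for x k
    proof -
      have "translate G \<one> x = x" using that by (auto simp: translate_def space_paths)
      then show ?thesis by (simp add: \<pi>_def code_def \<iota>\<kappa>')
    qed
    then have "AE x in Pcount. (\<forall>k. x \<in> R (j k) \<longleftrightarrow> cantor_digits (\<pi> x) (\<kappa> (\<one>, j k)))"
      by (intro AE_I2) simp
    with j have "AE x in Pcount. x \<in> A \<longleftrightarrow> \<pi> x \<in> B"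
      by eventually_elim (simp add: B_def)
    ultimately show ?thesis by blast
  qed
  ultimately have "poisson_boundary G \<mu> act \<pi>"
    unfolding poisson_boundary_def ergodic_components_def
    using \<pi>_meas shift act_\<pi>
    by (auto simp: \<I>_def sets_Pcount measurable_cong_sets[OF sets_Pcount refl])
  then show ?thesis by blast
qed

end

section \<open>The limit configuration\<close>

text \<open>Convergence of integers is eventual constancy, which is a countable condition.\<close>

lemma measurable_lim_discrete:
  fixes f :: "nat \<Rightarrow> 'a \<Rightarrow> int"
  assumes [measurable]: "\<And>n. f n \<in> M \<rightarrow>\<^sub>M count_space UNIV"
  shows "Measurable.pred M (\<lambda>x. convergent (\<lambda>n. f n x))"
    and "(\<lambda>x. lim (\<lambda>n. f n x)) \<in> M \<rightarrow>\<^sub>M count_space UNIV"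
proof -
  have conv: "(\<lambda>n. f n x) \<longlonglongrightarrow> L \<longleftrightarrow> (\<exists>K. \<forall>n\<ge>K. f n x = L)" for x L
    unfolding tendsto_discrete eventually_sequentially ..
  show c [measurable]: "Measurable.pred M (\<lambda>x. convergent (\<lambda>n. f n x))"
    unfolding convergent_def conv by measurable
  \<comment> \<open>For a divergent sequence \<open>lim\<close> describes an object with an empty
    property, which is one and the same integer for all such sequences.\<close>
  have l: "lim (\<lambda>n. f n x) = L \<longleftrightarrow> (\<lambda>n. f n x) \<longlonglongrightarrow> L \<or>
      \<not> convergent (\<lambda>n. f n x) \<and> (THE L::int. False) = L" for x L
  proof (cases "convergent (\<lambda>n. f n x)")
    case True
    then show ?thesis using limI convergent_LIMSEQ_iff by blast
  next
    case False
    then have "\<And>L. \<not> (\<lambda>n. f n x) \<longlonglongrightarrow> L" by (auto simp: convergent_def)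
    then have "lim (\<lambda>n. f n x) = (THE L::int. False)" unfolding lim_def by simp
    then show ?thesis using False \<open>\<And>L. \<not> (\<lambda>n. f n x) \<longlonglongrightarrow> L\<close> by simp
  qed
  show "(\<lambda>x. lim (\<lambda>n. f n x)) \<in> M \<rightarrow>\<^sub>M count_space UNIV"
  proof (subst measurable_count_space_eq2_countable, intro conjI ballI)
    fix L :: int
    have "Measurable.pred M (\<lambda>x. lim (\<lambda>n. f n x) = L)" unfolding l conv by measurable
    then show "(\<lambda>x. lim (\<lambda>n. f n x)) -` {L} \<inter> space M \<in> sets M"
      by (simp add: Measurable.pred_def vimage_def Int_def conj_commute)
  qed auto
qed

lemma sets_Collect_ball_countable:
  assumes "countable I" "\<And>i. i \<in> I \<Longrightarrow> {x \<in> space M. P i x} \<in> sets M"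
  shows "{x \<in> space M. \<forall>i\<in>I. P i x} \<in> sets M"
proof -
  have "(\<Union>i\<in>I. space M - {x \<in> space M. P i x}) \<in> sets M"
    using assms by (intro sets.countable_UN') auto
  moreover have "{x \<in> space M. \<forall>i\<in>I. P i x} = space M - (\<Union>i\<in>I. space M - {x \<in> space M. P i x})" by auto
  ultimately show ?thesis by auto
qed

section \<open>The action on configurations\<close>

lemma space_config_space: "space config_space = dyadic_rationals \<rightarrow>\<^sub>E UNIV"
  by (simp add: config_space_def space_PiM)

lemma config_ext:
  assumes "C \<in> space config_space" "D \<in> space config_space"
    "\<And>\<gamma>. \<gamma> \<in> dyadic_rationals \<Longrightarrow> C \<gamma> = D \<gamma>"
  shows "C = D"
  using assms unfolding space_config_space by (rule PiE_ext)

lemma measurable_config_coord: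
  assumes "\<gamma> \<in> dyadic_rationals"
  shows "(\<lambda>C. C \<gamma>) \<in> config_space \<rightarrow>\<^sub>M count_space UNIV"
  unfolding config_space_def using assms by measurable

lemma measurable_config_spaceI:
  assumes "\<And>x. x \<in> space M \<Longrightarrow> f x \<in> extensional dyadic_rationals"
    and "\<And>\<gamma>. \<gamma> \<in> dyadic_rationals \<Longrightarrow> (\<lambda>x. f x \<gamma>) \<in> M \<rightarrow>\<^sub>M count_space UNIV"
  shows "f \<in> M \<rightarrow>\<^sub>M config_space"
  unfolding config_space_def
  by (rule measurable_PiM_single') (use assms in \<open>auto simp: PiE_def\<close>)

lemma pred_config_eq:
  assumes f: "f \<in> M \<rightarrow>\<^sub>M config_space" and g: "g \<in> M \<rightarrow>\<^sub>M config_space"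
  shows "{x \<in> space M. f x = g x} \<in> sets M"
proof -
  have "{x \<in> space M. f x = g x} = {x \<in> space M. \<forall>\<gamma>\<in>dyadic_rationals. f x \<gamma> = g x \<gamma>}"
    using measurable_space[OF f] measurable_space[OF g]
    by (auto intro: config_ext)
  also have "\<dots> \<in> sets M"
  proof (rule sets_Collect_ball_countable[OF countable_dyadic_rationals])
    fix \<gamma> assume "\<gamma> \<in> dyadic_rationals"
    from measurable_compose[OF f measurable_config_coord[OF this]]
      measurable_compose[OF g measurable_config_coord[OF this]]
    have "Measurable.pred M (\<lambda>x. f x \<gamma> = g x \<gamma>)" by measurable
    then show "{x \<in> space M. f x \<gamma> = g x \<gamma>} \<in> sets M" by (simp add: Measurable.pred_def)
  qed
  finally show ?thesis .
qed

text \<open>Valid also for paths without a limit, because \<open>lim\<close> depends only on the set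
  of limits, which ignores the first term. Exactness matters: the ergodic components are tested on
  strictly invariant sets.\<close>

lemma limit_config_time_shift: "limit_config (time_shift x) = limit_config x"
proof (rule ext)
  fix \<gamma>
  have "(\<lambda>n. config (x (Suc n)) \<gamma>) \<longlonglongrightarrow> L \<longleftrightarrow> (\<lambda>n. config (x n) \<gamma>) \<longlonglongrightarrow> L" for L
    by (rule filterlim_sequentially_Suc)
  then show "limit_config (time_shift x) \<gamma> = limit_config x \<gamma>"
    by (simp add: limit_config_def time_shift_def lim_def)
qed

lemma config_action_in_space:
  "C \<in> space config_space \<Longrightarrow> config_action g C \<in> space config_space"
  by (simp add: config_action_def space_config_space)

lemma config_action_eq:
  "C \<in> space config_space \<Longrightarrow> \<gamma> \<in> dyadic_rationals \<Longrightarrow> config_action g C \<gamma> = config g \<gamma> + C (g \<gamma>)"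
  by (simp add: config_action_def)

lemma config_action_mult:
  assumes "g \<in> carrier F_tilde" "h \<in> carrier F_tilde" "C \<in> space config_space"
  shows "config_action (g \<otimes>\<^bsub>F_tilde\<^esub> h) C = config_action g (config_action h C)"
proof (rule config_ext)
  fix \<gamma> assume \<gamma>: "\<gamma> \<in> dyadic_rationals"
  show "config_action (g \<otimes>\<^bsub>F_tilde\<^esub> h) C \<gamma> = config_action g (config_action h C) \<gamma>"
    using \<gamma> F_tilde_dyadic[OF assms(1) \<gamma>] config_cocycle[OF assms(1,2) \<gamma>] assms(3)
    by (simp add: config_action_eq config_action_in_space)
qed (intro config_action_in_space assms)+

lemma measurable_config_action:
  assumes "g \<in> carrier F_tilde"
  shows "config_action g \<in> config_space \<rightarrow>\<^sub>M config_space"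
proof (rule measurable_config_spaceI)
  fix C assume "C \<in> space config_space"
  from config_action_in_space[OF this] show "config_action g C \<in> extensional dyadic_rationals"
    by (simp add: space_config_space PiE_def)
next
  fix \<gamma> assume \<gamma>: "\<gamma> \<in> dyadic_rationals"
  have "(\<lambda>C. config g \<gamma> + C (g \<gamma>)) \<in> config_space \<rightarrow>\<^sub>M count_space UNIV"
    by (rule measurable_compose[OF measurable_config_coord[OF F_tilde_dyadic[OF assms \<gamma>]]]) simp
  then show "(\<lambda>C. config_action g C \<gamma>) \<in> config_space \<rightarrow>\<^sub>M count_space UNIV"
    using \<gamma> by (subst measurable_cong[OF config_action_eq]) auto
qed

lemma config_action_one: 
  assumes "C \<in> space config_space"
  shows "config_action \<one>\<^bsub>F_tilde\<^esub> C = C"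
proof (rule config_ext)
  fix \<gamma> assume \<gamma>: "\<gamma> \<in> dyadic_rationals"
  then show "config_action \<one>\<^bsub>F_tilde\<^esub> C \<gamma> = C \<gamma>"
    using assms dyadic_slopes_affine(2)[of id 0 \<gamma>] by (simp add: config_action_eq)
qed (intro config_action_in_space assms)+

lemma group_action_config: "group_action F_tilde (space config_space) config_action"
proof (rule group_actionI[OF group_F_tilde])
  show "config_action g \<in> extensional (space config_space)" for g
    by (simp add: config_action_def)
qed (use config_action_in_space config_action_one config_action_mult in auto)

context F_tilde_walk begin

abbreviation "conv x \<equiv> \<forall>\<gamma>\<in>dyadic_rationals. convergent (\<lambda>n. config (x n) \<gamma>)"

lemma measurable_config_path [measurable]:
  "(\<lambda>x. config (x n) \<gamma>) \<in> paths \<rightarrow>\<^sub>M count_space UNIV"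
  by (rule measurable_compose[OF measurable_coord(1)]) simp

lemma pred_conv: "Measurable.pred paths conv"
proof -
  have "{x \<in> space paths. conv x} \<in> sets paths"
  proof (rule sets_Collect_ball_countable[OF countable_dyadic_rationals])
    fix \<gamma>
    show "{x \<in> space paths. convergent (\<lambda>n. config (x n) \<gamma>)} \<in> sets paths"
      using measurable_lim_discrete(1)[of "\<lambda>n x. config (x n) \<gamma>" paths] by (simp add: Measurable.pred_def)
  qed
  then show ?thesis by (simp add: Measurable.pred_def)
qed

lemma limit_config_measurable: "limit_config \<in> paths \<rightarrow>\<^sub>M config_space"
proof (rule measurable_config_spaceI)
  fix \<gamma> :: real assume "\<gamma> \<in> dyadic_rationals"
  then show "(\<lambda>x. limit_config x \<gamma>) \<in> paths \<rightarrow>\<^sub>M count_space UNIV"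
    using measurable_lim_discrete(2)[of "\<lambda>n x. config (x n) \<gamma>" paths] by (simp add: limit_config_def)
qed (simp add: limit_config_def)

lemma AE_conv: "AE x in Pone. conv x"
proof -
  have "AE h in incr. \<forall>\<gamma>\<in>dyadic_rationals. convergent (\<lambda>n. config (walk F_tilde id h n) \<gamma>)"
    using AE_config_converges by (subst AE_ball_countable[OF countable_dyadic_rationals]) blast
  then show ?thesis by (subst AE_P1_iff[OF pred_conv]) simp
qed

lemma limit_configI:
  assumes "conv x" "\<gamma> \<in> dyadic_rationals"
  shows "(\<lambda>n. config (x n) \<gamma>) \<longlonglongrightarrow> limit_config x \<gamma>"
  using assms by (simp add: limit_config_def convergent_LIMSEQ_iff)

lemma limit_config_in_space: "limit_config x \<in> space config_space"
  by (simp add: space_config_space limit_config_def)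

text \<open>The cocycle identity passes to the limit: the coordinate \<gamma> of the translated path
  is governed by the coordinate \<open>g \<gamma>\<close> of \<open>x\<close>.\<close>

lemma limit_config_translate:
  assumes g: "g \<in> carrier F_tilde" and x: "x \<in> space paths" and c: "conv x"
  shows "conv (translate F_tilde g x)" "limit_config (translate F_tilde g x) = config_action g (limit_config x)"
proof -
  have lim: "(\<lambda>n. config (translate F_tilde g x n) \<gamma>) \<longlonglongrightarrow> config_action g (limit_config x) \<gamma>"
    if \<gamma>: "\<gamma> \<in> dyadic_rationals" for \<gamma>
  proof -
    have "config (translate F_tilde g x n) \<gamma> = config g \<gamma> + config (x n) (g \<gamma>)" for n
      unfolding translate_def using x by (intro config_cocycle g \<gamma>) (simp add: space_paths)
    then show ?thesis
      using limit_configI[OF c F_tilde_dyadic[OF g \<gamma>]]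
      by (simp add: config_action_eq limit_config_in_space \<gamma> tendsto_add)
  qed
  then show "conv (translate F_tilde g x)" by (auto simp: convergent_def)
  show "limit_config (translate F_tilde g x) = config_action g (limit_config x)"
  proof (rule config_ext)
    fix \<gamma> assume "\<gamma> \<in> dyadic_rationals"
    then show "limit_config (translate F_tilde g x) \<gamma> = config_action g (limit_config x) \<gamma>"
      using limI[OF lim] by (simp add: limit_config_def)
  qed (intro limit_config_in_space config_action_in_space)+
qed

lemma AE_conv_Pcount: "AE x in Pcount. conv x"
proof (subst AE_Pcount_iff[OF pred_conv], rule ballI)
  fix g assume g: "g \<in> carrier F_tilde"
  show "AE x in Pone. conv (translate F_tilde g x)"
    using AE_conv AE_space by eventually_elim (rule limit_config_translate(1)[OF g], simp_all)
qed

section \<open>The limit distribution and its quasi-invariance\<close>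

abbreviation "\<Lambda> \<equiv> limit_distribution \<mu>"

lemma sets_\<Lambda> [measurable_cong]: "sets \<Lambda> = sets config_space"
  by (simp add: limit_distribution_def)

lemma space_\<Lambda>: "space \<Lambda> = space config_space"
  by (simp add: limit_distribution_def)

lemma limit_config_measurable_Pone: "limit_config \<in> Pone \<rightarrow>\<^sub>M config_space"
  using limit_config_measurable by (simp add: measurable_cong_sets[OF sets_P1 refl])

lemma null_sets_\<Lambda>_iff: "N \<in> null_sets \<Lambda> \<longleftrightarrow> N \<in> sets config_space \<and> (AE x in Pone. limit_config x \<notin> N)"
proof -
  have "(AE x in Pone. limit_config x \<notin> N) \<longleftrightarrow> limit_config -` N \<inter> space Pone \<in> null_sets Pone"
    if "N \<in> sets config_space"
    using measurable_sets[OF limit_config_measurable_Pone that]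
    by (subst AE_iff_null_sets) (auto intro!: AE_cong)
  then show ?thesis
    unfolding limit_distribution_def null_sets_distr_iff[OF limit_config_measurable_Pone] by blast
qed

text \<open>By stationarity \<lambda> is the \<mu>-average of its images, hence dominates its image
  under each \<open>s\<close> in the support. Domination is inherited by products, and every group
  element is a product of such \<open>s\<close>.\<close>

lemma null_sets_\<Lambda>_vimage:
  assumes "g \<in> carrier F_tilde" "N \<in> null_sets \<Lambda>"
  shows "config_action g -` N \<inter> space config_space \<in> null_sets \<Lambda>"
proof -
  have "g \<in> semigroup_generated F_tilde (set_pmf \<mu>)"
    using assms nondeg by (simp add: strictly_nondegenerate_def)
  then show ?thesis using assms(2)
  proof (induction arbitrary: N)
    case (incl s)
    have s: "s \<in> carrier F_tilde" using incl supp by blast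
    have N: "N \<in> sets config_space" "AE x in Pone. limit_config x \<notin> N"
      using incl unfolding null_sets_\<Lambda>_iff by auto
    have "Measurable.pred paths (\<lambda>x. limit_config x \<notin> N)"
      using limit_config_measurable N(1) by measurable
    then have "AE x in Pone. limit_config (translate F_tilde s x) \<notin> N"
      by (rule AE_P1_time_shift[OF _ _ incl(1)]) (simp add: limit_config_time_shift N(2))
    then have "AE x in Pone. limit_config x \<notin> config_action s -` N \<inter> space config_space"
      using AE_conv AE_space
      by eventually_elim (simp add: limit_config_translate(2)[OF s])
    then show ?case
      using measurable_sets[OF measurable_config_action[OF s] N(1)] unfolding null_sets_\<Lambda>_iff by simp
  next
    case (mult s t)
    then have st: "s \<in> carrier F_tilde" "t \<in> carrier F_tilde"
      using nondeg by (simp_all add: strictly_nondegenerate_def)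
    have eq: "config_action (s \<otimes>\<^bsub>F_tilde\<^esub> t) -` N \<inter> space config_space =
        config_action t -` (config_action s -` N \<inter> space config_space) \<inter> space config_space"
      using config_action_mult[OF st] config_action_in_space by auto
    show ?case unfolding eq by (rule mult.IH(2)[OF mult.IH(1)[OF mult.prems]])
  qed
qed

text \<open>Preimages of null sets under \<open>g\<close> give one inclusion; the other is the same
  fact for the inverse of \<open>g\<close>.\<close>

lemma measure_G_space_\<Lambda>: "measure_G_space F_tilde \<Lambda> config_action"
proof -
  have m: "config_action g \<in> \<Lambda> \<rightarrow>\<^sub>M \<Lambda>" if "g \<in> carrier F_tilde" for g
    using measurable_config_action[OF that] by (simp add: measurable_cong_sets[OF sets_\<Lambda> sets_\<Lambda>])
  have "null_sets (distr \<Lambda> \<Lambda> (config_action g)) = null_sets \<Lambda>" if g: "g \<in> carrier F_tilde" for g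
  proof (intro Set.set_eqI iffI)
    fix N assume "N \<in> null_sets \<Lambda>"
    then show "N \<in> null_sets (distr \<Lambda> \<Lambda> (config_action g))"
      using null_sets_\<Lambda>_vimage[OF g] unfolding null_sets_distr_iff[OF m[OF g]] space_\<Lambda> by auto
  next
    fix N assume "N \<in> null_sets (distr \<Lambda> \<Lambda> (config_action g))"
    then have N: "config_action g -` N \<inter> space config_space \<in> null_sets \<Lambda>" "N \<in> sets \<Lambda>"
      unfolding null_sets_distr_iff[OF m[OF g]] space_\<Lambda> by auto
    have g': "inv\<^bsub>F_tilde\<^esub> g \<in> carrier F_tilde" using g by (rule inv_closed)
    have id: "config_action g (config_action (inv\<^bsub>F_tilde\<^esub> g) C) = C" if "C \<in> space config_space" for C
      using config_action_mult[OF g g' that] config_action_one[OF that] r_inv[OF g] by simp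
    have "config_action (inv\<^bsub>F_tilde\<^esub> g) -` (config_action g -` N \<inter> space config_space) \<inter> space config_space = N"
      using id config_action_in_space sets.sets_into_space[OF N(2)] unfolding space_\<Lambda> by auto
    then show "N \<in> null_sets \<Lambda>" using null_sets_\<Lambda>_vimage[OF g' N(1)] by simp
  qed
  then show ?thesis
    unfolding measure_G_space_def measurable_action_def space_\<Lambda> using m group_action_config by blast
qed

lemma nontrivial_\<Lambda>: "nontrivial_measure \<Lambda>"
  unfolding nontrivial_measure_def
proof
  assume "\<exists>C\<in>space \<Lambda>. \<Lambda> = return \<Lambda> C"
  then obtain C where C: "C \<in> space config_space" "\<Lambda> = return \<Lambda> C" by (auto simp: space_\<Lambda>)
  have B: "B_gen \<in> carrier F_tilde" by (simp add: carrier_F_tilde generate.incl)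
  let ?N = "{D \<in> space config_space. D \<noteq> C}"
  have "?N = space config_space - {D \<in> space config_space. D = C}" by blast
  then have meas: "?N \<in> sets config_space"
    using pred_config_eq[of "\<lambda>D. D" config_space "\<lambda>_. C"] C(1) by auto
  have null: "N \<in> null_sets \<Lambda> \<longleftrightarrow> C \<notin> N" if "N \<in> sets config_space" for N
  proof -
    have "emeasure \<Lambda> N = indicator N C"
      by (subst C(2)) (simp add: emeasure_return that sets_\<Lambda>)
    then show ?thesis using that by (auto simp: null_sets_def sets_\<Lambda> indicator_def)
  qed
  \<comment> \<open>The complement of \<open>C\<close> is null, hence so is its preimage under
    \<open>B_gen\<close>. A null set cannot contain \<open>C\<close>, so \<open>B_gen\<close> fixes
    \<open>C\<close>.\<close>
  have "config_action B_gen -` ?N \<inter> space config_space \<in> null_sets \<Lambda>"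
    by (rule null_sets_\<Lambda>_vimage[OF B]) (simp add: null[OF meas])
  moreover have "config_action B_gen -` ?N \<inter> space config_space \<in> sets config_space"
    by (rule measurable_sets[OF measurable_config_action[OF B] meas])
  ultimately have "config_action B_gen C = C"
    using null C(1) config_action_in_space[OF C(1)] by auto
  moreover have "config_action B_gen C 0 = -1 + C 0"
    using dyadic_rationals_of_int[of 0] by (simp add: config_action_eq C(1) config_B B_gen_def)
  ultimately show False by simp
qed

text \<open>That a coordinate of the limit takes a given value is a shift-invariant event, hence up
  to a null set the preimage of a Borel set under \<open>\<pi>\<close>. Countably many coordinates
  and values leave a single null set. The target of \<open>\<pi>\<close> is any Polish space, so
  that the constructed boundary and an arbitrary one are both covered.\<close>

lemma limit_config_factor:
  fixes \<pi> :: "(nat \<Rightarrow> real \<Rightarrow> real) \<Rightarrow> 'b::polish_space"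
  assumes "poisson_boundary F_tilde \<mu> act \<pi>"
  shows "\<exists>\<phi>. \<phi> \<in> borel \<rightarrow>\<^sub>M config_space \<and> (AE x in Pcount. \<phi> (\<pi> x) = limit_config x)"
proof -
  have erg: "\<forall>A\<in>sets Pcount. time_shift -` A \<inter> space Pcount = A \<longrightarrow>
      (\<exists>B\<in>sets borel. AE x in Pcount. x \<in> A \<longleftrightarrow> \<pi> x \<in> B)"
    using assms unfolding poisson_boundary_def ergodic_components_def by (elim conjE)
  have ex: "\<exists>B. B \<in> sets borel \<and> (AE x in Pcount. limit_config x \<gamma> = k \<longleftrightarrow> \<pi> x \<in> B)"
    if \<gamma>: "\<gamma> \<in> dyadic_rationals" for \<gamma> k
  proof -
    let ?A = "{x \<in> space Pcount. limit_config x \<gamma> = k}"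
    have "?A = (\<lambda>x. limit_config x \<gamma>) -` {k} \<inter> space paths" by auto
    also have "\<dots> \<in> sets paths"
      by (rule measurable_sets[OF measurable_compose[OF limit_config_measurable measurable_config_coord[OF \<gamma>]]]) simp
    finally have "?A \<in> sets Pcount" by (simp add: sets_Pcount)
    moreover have "time_shift -` ?A \<inter> space Pcount = ?A"
      using measurable_space[OF measurable_time_shift] by (auto simp: limit_config_time_shift)
    ultimately obtain B where B: "B \<in> sets borel" "AE x in Pcount. x \<in> ?A \<longleftrightarrow> \<pi> x \<in> B"
      using bspec[OF erg, of ?A] by blast
    from B(2) AE_space have "AE x in Pcount. limit_config x \<gamma> = k \<longleftrightarrow> \<pi> x \<in> B"
      by eventually_elim simp
    then show ?thesis using B(1) by blast
  qed
  define B where "B \<gamma> k = (SOME B. B \<in> sets borel \<and> (AE x in Pcount. limit_config x \<gamma> = k \<longleftrightarrow> \<pi> x \<in> B))"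
    for \<gamma> k
  have B: "B \<gamma> k \<in> sets borel" "AE x in Pcount. limit_config x \<gamma> = k \<longleftrightarrow> \<pi> x \<in> B \<gamma> k"
    if "\<gamma> \<in> dyadic_rationals" for \<gamma> k
    using someI_ex[OF ex[OF that]] unfolding B_def by simp_all
  \<comment> \<open>Almost everywhere exactly one value is admissible at each coordinate and the
    least index finds it; on the exceptional set the search still defines a measurable
    function.\<close>
  define \<phi> where "\<phi> \<xi> = (\<lambda>\<gamma>\<in>dyadic_rationals. from_nat (LEAST n. \<xi> \<in> B \<gamma> (from_nat n)) :: int)" for \<xi>
  have "\<phi> \<in> borel \<rightarrow>\<^sub>M config_space"
  proof (rule measurable_config_spaceI)
    fix \<gamma> :: real assume \<gamma>: "\<gamma> \<in> dyadic_rationals"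
    note [measurable] = B(1)[OF \<gamma>]
    have "(\<lambda>\<xi>. LEAST n. \<xi> \<in> B \<gamma> (from_nat n)) \<in> borel \<rightarrow>\<^sub>M count_space UNIV"
      by (rule measurable_Least) measurable
    from measurable_compose[OF this, of "from_nat :: nat \<Rightarrow> int" "count_space UNIV"]
    show "(\<lambda>\<xi>. \<phi> \<xi> \<gamma>) \<in> borel \<rightarrow>\<^sub>M count_space UNIV" using \<gamma> by (simp add: \<phi>_def)
  qed (simp add: \<phi>_def)
  moreover have "AE x in Pcount. \<phi> (\<pi> x) = limit_config x"
  proof -
    have "AE x in Pcount. \<forall>\<gamma>\<in>dyadic_rationals. \<forall>k\<in>UNIV. limit_config x \<gamma> = k \<longleftrightarrow> \<pi> x \<in> B \<gamma> k"
      by (intro AE_ball_countable'[OF _ countable_dyadic_rationals] AE_ball_countable'[OF _ countableI_type] B(2))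
    then show ?thesis
    proof eventually_elim
      case (elim x)
      show ?case
      proof (rule config_ext)
        fix \<gamma> assume \<gamma>: "\<gamma> \<in> dyadic_rationals"
        have "\<pi> x \<in> B \<gamma> k \<longleftrightarrow> k = limit_config x \<gamma>" for k
          using bspec[OF bspec[OF elim \<gamma>] UNIV_I, of k] by auto
        moreover have "from_nat (LEAST n. from_nat n = limit_config x \<gamma>) = limit_config x \<gamma>"
          by (rule LeastI[of "\<lambda>n. from_nat n = limit_config x \<gamma>" "to_nat (limit_config x \<gamma>)"]) simp
        ultimately show "\<phi> (\<pi> x) \<gamma> = limit_config x \<gamma>" using \<gamma> by (simp add: \<phi>_def)
      qed (use limit_config_in_space[of x] in \<open>simp_all add: \<phi>_def space_config_space\<close>)
    qed
  qed
  ultimately show ?thesis by blast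
qed

lemma AE_Pcount_Pone:
  assumes "AE x in Pcount. Q x"
  shows "AE x in Pone. Q x"
proof -
  have "AE x in Pone. Q (translate F_tilde \<one>\<^bsub>F_tilde\<^esub> x)"
    by (rule AE_Pcount_imp_P1[OF assms one_closed])
  then show ?thesis by (simp add: translate_def)
qed

text \<open>Equivariance of \<open>\<phi>\<close> is checked on the path space, where both sides
  equal the limit configuration of the translated path.\<close>

lemma mu_boundary_\<Lambda>: "mu_boundary F_tilde \<mu> \<Lambda> config_action"
proof -
  obtain act :: "(real \<Rightarrow> real) \<Rightarrow> real \<Rightarrow> real" and \<pi> where pb: "poisson_boundary F_tilde \<mu> act \<pi>"
    using poisson_boundary_exists by blast
  obtain \<phi> where \<phi>: "\<phi> \<in> borel \<rightarrow>\<^sub>M config_space" "AE x in Pcount. \<phi> (\<pi> x) = limit_config x"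
    using limit_config_factor[OF pb] by blast
  have \<pi>: "\<pi> \<in> borel_measurable Pcount"
    and act: "\<And>g. g \<in> carrier F_tilde \<Longrightarrow> act g \<in> borel_measurable borel"
    and equiv: "\<And>g. g \<in> carrier F_tilde \<Longrightarrow> AE x in Pcount. \<pi> (translate F_tilde g x) = act g (\<pi> x)"
    using pb unfolding poisson_boundary_def ergodic_components_def measurable_action_def by auto
  have \<pi>': "\<pi> \<in> borel_measurable Pone"
    using \<pi> by (simp add: measurable_cong_sets[OF sets_P1 refl] measurable_cong_sets[OF sets_Pcount refl])
  have "AE \<xi> in distr Pcount borel \<pi>. \<phi> (act g \<xi>) = config_action g (\<phi> \<xi>)"
    if g: "g \<in> carrier F_tilde" for g
  proof (subst AE_distr_iff[OF \<pi>])
    show "{\<xi> \<in> space borel. \<phi> (act g \<xi>) = config_action g (\<phi> \<xi>)} \<in> sets borel"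
      by (rule pred_config_eq[OF measurable_compose[OF act[OF g] \<phi>(1)]
            measurable_compose[OF \<phi>(1) measurable_config_action[OF g]]])
    have "AE x in Pcount. \<phi> (\<pi> (translate F_tilde g x)) = limit_config (translate F_tilde g x)"
      by (rule AE_Pcount_translated[OF \<phi>(2) g])
    then show "AE x in Pcount. \<phi> (act g (\<pi> x)) = config_action g (\<phi> (\<pi> x))"
      using \<phi>(2) equiv[OF g] AE_conv_Pcount AE_space
    proof eventually_elim
      case (elim x)
      then show ?case using limit_config_translate(2)[OF g _ elim(4)] by simp
    qed
  qed
  moreover have "\<Lambda> = distr (harmonic_measure F_tilde \<mu> \<pi>) \<Lambda> \<phi>"
  proof -
    have "distr (harmonic_measure F_tilde \<mu> \<pi>) \<Lambda> \<phi> = distr Pone config_space (\<phi> \<circ> \<pi>)"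
      unfolding harmonic_measure_def
      using distr_distr[OF \<phi>(1) \<pi>'] by (simp add: distr_cong[OF refl sets_\<Lambda> refl])
    also have "\<dots> = \<Lambda>"
      unfolding limit_distribution_def
      by (rule distr_cong_AE[OF refl refl _ measurable_comp[OF \<pi>' \<phi>(1)] limit_config_measurable_Pone])
        (use AE_Pcount_Pone[OF \<phi>(2)] in simp)
    finally show ?thesis by simp
  qed
  moreover have "\<phi> \<in> borel \<rightarrow>\<^sub>M \<Lambda>" using \<phi>(1) by (simp add: measurable_cong_sets[OF refl sets_\<Lambda>])
  ultimately show ?thesis
    unfolding mu_boundary_def using measure_G_space_\<Lambda> pb by blast
qed

text \<open>The limit configuration is a function of the boundary point, so a point mass on the
  boundary would make \<lambda> a point mass.\<close>

lemma nontrivial_poisson_boundary: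
  fixes \<pi> :: "(nat \<Rightarrow> real \<Rightarrow> real) \<Rightarrow> 'b::polish_space"
  assumes pb: "poisson_boundary F_tilde \<mu> act \<pi>"
  shows "nontrivial_measure (harmonic_measure F_tilde \<mu> \<pi>)"
  unfolding nontrivial_measure_def
proof
  let ?H = "harmonic_measure F_tilde \<mu> \<pi>"
  assume "\<exists>\<xi>\<in>space ?H. ?H = return ?H \<xi>"
  then obtain \<xi> where \<xi>: "?H = return ?H \<xi>" by blast
  obtain \<phi> where \<phi>: "\<phi> \<in> borel \<rightarrow>\<^sub>M config_space" "AE x in Pcount. \<phi> (\<pi> x) = limit_config x"
    using limit_config_factor[OF pb] by blast
  have "\<pi> \<in> borel_measurable Pcount"
    using pb unfolding poisson_boundary_def ergodic_components_def by auto
  then have \<pi>: "\<pi> \<in> borel_measurable Pone"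
    by (simp add: measurable_cong_sets[OF sets_P1 refl] measurable_cong_sets[OF sets_Pcount refl])
  have "sets ?H = sets borel" by (simp add: harmonic_measure_def)
  then have "?H = return borel \<xi>" using \<xi> return_sets_cong by metis
  moreover have "AE \<zeta> in return borel \<xi>. \<zeta> = \<xi>"
    by (subst AE_return) auto
  ultimately have "AE \<zeta> in distr Pone borel \<pi>. \<zeta> = \<xi>" by (simp only: harmonic_measure_def)
  from AE_distrD[OF \<pi> this] AE_Pcount_Pone[OF \<phi>(2)]
  have ae: "AE x in Pone. limit_config x = \<phi> \<xi>" by eventually_elim simp
  have in_space: "\<phi> \<xi> \<in> space config_space" using measurable_space[OF \<phi>(1)] by simp
  have "\<Lambda> = distr Pone config_space (\<lambda>_. \<phi> \<xi>)"
    unfolding limit_distribution_def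
    by (rule distr_cong_AE[OF refl refl ae limit_config_measurable_Pone]) (use in_space in simp)
  also have "\<dots> = return config_space (\<phi> \<xi>)"
    by (rule prob_space.distr_const[OF prob_space_P1 in_space])
  also have "\<dots> = return \<Lambda> (\<phi> \<xi>)" by (rule return_cong[OF sets_\<Lambda>[symmetric]])
  finally show False using nontrivial_\<Lambda> in_space unfolding nontrivial_measure_def space_\<Lambda> by blast
qed

end

theorem theorem35:
  fixes \<mu> :: "(real \<Rightarrow> real) pmf"
  assumes "set_pmf \<mu> \<subseteq> carrier F_tilde"
    and "finite (set_pmf \<mu>)"
    and "strictly_nondegenerate F_tilde \<mu>"
  shows "(AE x in path_measure F_tilde \<mu>.
            \<forall>\<gamma>\<in>dyadic_rationals. (\<lambda>n. config (x n) \<gamma>) \<longlonglongrightarrow> limit_config x \<gamma>)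
       \<and> limit_config \<in> path_space F_tilde \<rightarrow>\<^sub>M config_space
       \<and> mu_boundary F_tilde \<mu> (limit_distribution \<mu>) config_action
       \<and> nontrivial_measure (limit_distribution \<mu>)
       \<and> (\<forall>(act :: (real \<Rightarrow> real) \<Rightarrow> 'b \<Rightarrow> 'b) (\<pi> :: (nat \<Rightarrow> real \<Rightarrow> real) \<Rightarrow> 'b :: polish_space).
            poisson_boundary F_tilde \<mu> act \<pi> \<longrightarrow>
            nontrivial_measure (harmonic_measure F_tilde \<mu> \<pi>))"
proof -
  interpret F_tilde_walk \<mu> by unfold_locales fact+
  have "AE x in path_measure F_tilde \<mu>.
      \<forall>\<gamma>\<in>dyadic_rationals. (\<lambda>n. config (x n) \<gamma>) \<longlonglongrightarrow> limit_config x \<gamma>"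
    using AE_conv
  proof eventually_elim
    case (elim x)
    then show ?case using limit_configI[of x] by blast
  qed
  then show ?thesis
    using limit_config_measurable mu_boundary_\<Lambda> nontrivial_\<Lambda> nontrivial_poisson_boundary by blast
qed

end
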